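(* For every integer $g\geq 3$ there exists a planar graph $G$ of girth at least $g$ such that $\chi_{\ell}^{\star}(G)=4$.
   Context: All graphs are finite and simple. A list-assignment of a graph $G$ is a map $L$ assigning to each vertex $v$ a finite set $L(v)\subseteq\mathbb{N}$; it is $k$-fold if $|L(v)|=k$ for all $v$. An $L$-coloring is a proper coloring $c$ of $G$ with $c(v)\in L(v)$ for all $v$. For a $k$-fold list-assignment $L$, an $L$-packing is a collection of $k$ $L$-colorings $c_1,\dots,c_k$ such that for every vertex $v$ the values $c_1(v),\dots,c_k(v)$ are pairwise distinct (so they exhaust $L(v)$). The list packing number $\chi_{\ell}^{\star}(G)$ is the least integer $k\geq1$ such that every $k$-fold list-assignment of $G$ admits an $L$-packing. *)

theory Defs
  imports "HOL-Analysis.Analysis"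
begin

definition simple_graph :: "'a set \<Rightarrow> 'a set set \<Rightarrow> bool" where
  "simple_graph V E \<longleftrightarrow> finite V \<and> (\<forall>e\<in>E. e \<subseteq> V \<and> card e = 2)"

definition planar_graph :: "'a set \<Rightarrow> 'a set set \<Rightarrow> bool" where
  "planar_graph V E \<longleftrightarrow>
     (\<exists>(p :: 'a \<Rightarrow> complex) (\<gamma> :: 'a set \<Rightarrow> real \<Rightarrow> complex).
        inj_on p V \<and>
        (\<forall>e\<in>E. arc (\<gamma> e) \<and> {pathstart (\<gamma> e), pathfinish (\<gamma> e)} = p ` e
                 \<and> path_image (\<gamma> e) \<inter> p ` V = p ` e) \<and>
        (\<forall>e\<in>E. \<forall>e'\<in>E. e \<noteq> e' \<longrightarrow>
                 path_image (\<gamma> e) \<inter> path_image (\<gamma> e') \<subseteq> p ` (e \<inter> e')))"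

definition is_cycle :: "'a set \<Rightarrow> 'a set set \<Rightarrow> 'a list \<Rightarrow> bool" where
  "is_cycle V E cs \<longleftrightarrow> length cs \<ge> 3 \<and> distinct cs \<and> set cs \<subseteq> V \<and>
     (\<forall>i < length cs. {cs ! i, cs ! ((i + 1) mod length cs)} \<in> E)"

text \<open>Girth at least g: every cycle has length at least g (acyclic graphs have infinite girth).\<close>
definition girth_at_least :: "'a set \<Rightarrow> 'a set set \<Rightarrow> nat \<Rightarrow> bool" where
  "girth_at_least V E g \<longleftrightarrow> (\<forall>cs. is_cycle V E cs \<longrightarrow> length cs \<ge> g)"

definition k_fold :: "'a set \<Rightarrow> nat \<Rightarrow> ('a \<Rightarrow> nat set) \<Rightarrow> bool" where
  "k_fold V k L \<longleftrightarrow> (\<forall>v\<in>V. finite (L v) \<and> card (L v) = k)"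

definition L_coloring :: "'a set \<Rightarrow> 'a set set \<Rightarrow> ('a \<Rightarrow> nat set) \<Rightarrow> ('a \<Rightarrow> nat) \<Rightarrow> bool" where
  "L_coloring V E L c \<longleftrightarrow> (\<forall>v\<in>V. c v \<in> L v) \<and> (\<forall>u v. {u, v} \<in> E \<longrightarrow> c u \<noteq> c v)"

definition L_packing :: "'a set \<Rightarrow> 'a set set \<Rightarrow> nat \<Rightarrow> ('a \<Rightarrow> nat set) \<Rightarrow> (nat \<Rightarrow> 'a \<Rightarrow> nat) \<Rightarrow> bool" where
  "L_packing V E k L c \<longleftrightarrow> (\<forall>i<k. L_coloring V E L (c i)) \<and>
     (\<forall>v\<in>V. \<forall>i<k. \<forall>j<k. i \<noteq> j \<longrightarrow> c i v \<noteq> c j v)"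

definition list_packing_number :: "'a set \<Rightarrow> 'a set set \<Rightarrow> nat" where
  "list_packing_number V E = (LEAST k. k \<ge> 1 \<and>
     (\<forall>L. k_fold V k L \<longrightarrow> (\<exists>c. L_packing V E k L c)))"

end

theory Submission
  imports Defs
begin

text \<open>
  In a 3-packing every vertex \<open>v\<close> carries the word \<open>(c\<^sub>0 v, c\<^sub>1 v, c\<^sub>2 v)\<close>, an ordering of its list.
  Along an edge whose ends have the same list the cyclic orientation of the word is preserved, so
  arbitrarily long paths transmit this one bit. If the ends have lists \<open>{a, b, x}\<close> and \<open>{a, b, y}\<close>
  and their words are oppositely oriented (after identifying \<open>x\<close> with \<open>y\<close>), then each word determines the
  other. Hence a long odd cycle on which the two lists alternate, except for one edge joining two vertices with
  equal lists, forbids opposite orientations as soon as all vertices with the same list are linked by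
  paths carrying that list. Three such cycles, for the pairs among \<open>A = {1, 2, 3}\<close>, \<open>B = {1, 2, 4}\<close>,
  \<open>C = {1, 3, 4}\<close>, are incompatible, because going round the identifications
  \<open>3 \<mapsto> 4\<close>, \<open>2 \<mapsto> 3\<close>, \<open>4 \<mapsto> 2\<close> from \<open>A\<close> over \<open>B\<close> and \<open>C\<close> back to \<open>A\<close> reverses orientation.
  The graph can be drawn in the plane with all linking paths long. It is 2-degenerate, and in a list of
  size 4 one can always avoid two injectively coloured neighbours, so four colours suffice.
\<close>

section \<open>Packings, girth and planarity of general graphs\<close>

lemma avoid_id_and_permutation:
  fixes b :: "nat \<Rightarrow> nat"
  assumes "bij_betw b {..<4} {..<4}"
  shows "\<exists>d. bij_betw d {..<4} {..<4} \<and> (\<forall>i<4. d i \<noteq> i \<and> d i \<noteq> b i)"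
proof -
  have lt4: "{..<4::nat} = {0, 1, 2, 3}" by auto
  have all4: "(\<forall>i<4. P i) \<longleftrightarrow> P 0 \<and> P 1 \<and> P 2 \<and> P (3::nat)" for P
  proof -
    have "(\<forall>i<4. P i) \<longleftrightarrow> (\<forall>i\<in>{..<4}. P i)" by (simp add: Ball_def)
    then show ?thesis unfolding lt4 by simp
  qed
  have wit: "b 0 = d0 \<or> b 1 = d1 \<or> b 2 = d2 \<or> b 3 = d3 \<or> ?thesis"
    if "distinct [d0, d1, d2, d3]" "{d0, d1, d2, d3} \<subseteq> {0, 1, 2, 3}"
       "d0 \<noteq> 0" "d1 \<noteq> 1" "d2 \<noteq> 2" "d3 \<noteq> 3" for d0 d1 d2 d3 :: nat
  proof (cases "d0 \<noteq> b 0 \<and> d1 \<noteq> b 1 \<and> d2 \<noteq> b 2 \<and> d3 \<noteq> b 3")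
    case True
    define d where "d = (\<lambda>i::nat. if i = 0 then d0 else if i = 1 then d1 else if i = 2 then d2 else d3)"
    have "inj_on d {..<4}"
      using that(1) unfolding lt4 inj_on_def d_def by auto
    moreover have "d ` {..<4} \<subseteq> {..<4}"
      using that(2) unfolding lt4 d_def by auto
    ultimately have "bij_betw d {..<4} {..<4}"
      by (simp add: bij_betw_def endo_inj_surj)
    moreover have "\<forall>i<4. d i \<noteq> i \<and> d i \<noteq> b i"
      unfolding all4 using that True by (auto simp: d_def)
    ultimately show ?thesis by blast
  qed auto
  \<comment> \<open>These are the nine derangements of four points; each can fail as
    \<open>d\<close> only by agreeing with \<open>b\<close> somewhere. The final case check shows
    that no permutation \<open>b\<close> agrees somewhere with all nine.\<close>
  have "b 0 = 1 \<or> b 1 = 0 \<or> b 2 = 3 \<or> b 3 = 2 \<or> ?thesis"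
    "b 0 = 1 \<or> b 1 = 2 \<or> b 2 = 3 \<or> b 3 = 0 \<or> ?thesis"
    "b 0 = 1 \<or> b 1 = 3 \<or> b 2 = 0 \<or> b 3 = 2 \<or> ?thesis"
    "b 0 = 2 \<or> b 1 = 0 \<or> b 2 = 3 \<or> b 3 = 1 \<or> ?thesis"
    "b 0 = 2 \<or> b 1 = 3 \<or> b 2 = 0 \<or> b 3 = 1 \<or> ?thesis"
    "b 0 = 2 \<or> b 1 = 3 \<or> b 2 = 1 \<or> b 3 = 0 \<or> ?thesis"
    "b 0 = 3 \<or> b 1 = 0 \<or> b 2 = 1 \<or> b 3 = 2 \<or> ?thesis"
    "b 0 = 3 \<or> b 1 = 2 \<or> b 2 = 0 \<or> b 3 = 1 \<or> ?thesis"
    "b 0 = 3 \<or> b 1 = 2 \<or> b 2 = 1 \<or> b 3 = 0 \<or> ?thesis"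
    by (rule wit; simp)+
  moreover have "b i = 0 \<or> b i = 1 \<or> b i = 2 \<or> b i = 3" if "i < 4" for i
  proof -
    have "b i \<in> {0, 1, 2, 3}"
      using bij_betwE[OF assms] that unfolding lt4[symmetric] by simp
    then show ?thesis by simp
  qed
  then have "b 0 = 0 \<or> b 0 = 1 \<or> b 0 = 2 \<or> b 0 = 3" "b 1 = 0 \<or> b 1 = 1 \<or> b 1 = 2 \<or> b 1 = 3"
    "b 2 = 0 \<or> b 2 = 1 \<or> b 2 = 2 \<or> b 2 = 3" "b 3 = 0 \<or> b 3 = 1 \<or> b 3 = 2 \<or> b 3 = 3"
    by simp_all
  moreover have "b 0 \<noteq> b 1" "b 0 \<noteq> b 2" "b 0 \<noteq> b 3" "b 1 \<noteq> b 2" "b 1 \<noteq> b 3" "b 2 \<noteq> b 3"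
    using assms unfolding lt4 bij_betw_def inj_on_def by auto
  ultimately show ?thesis by smt
qed

lemma extend_injection_to_bijection:
  assumes "finite I" "finite X" "card I = card X" "inj_on a I"
  shows "\<exists>A. bij_betw A I X \<and> (\<forall>i\<in>I. a i \<in> X \<longrightarrow> A i = a i)"
proof -
  define J where "J = {i \<in> I. a i \<in> X}"
  have J: "J \<subseteq> I" "a ` J \<subseteq> X" "inj_on a J" "finite J"
    using assms by (auto simp: J_def intro: inj_on_subset)
  have "card (I - J) = card (X - a ` J)"
    using assms J by (simp add: card_Diff_subset card_image)
  then obtain r where r: "bij_betw r (I - J) (X - a ` J)"
    using assms finite_same_card_bij by (metis finite_Diff)
  define A where "A = (\<lambda>i. if i \<in> J then a i else r i)"
  have "bij_betw A J (a ` J)"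
    using J by (auto simp: A_def bij_betw_def inj_on_def)
  moreover have "bij_betw A (I - J) (X - a ` J)"
    using r by (subst bij_betw_cong[of _ A r]) (auto simp: A_def)
  ultimately have "bij_betw A (J \<union> (I - J)) (a ` J \<union> (X - a ` J))"
    by (rule bij_betw_combine) auto
  moreover have "J \<union> (I - J) = I" "a ` J \<union> (X - a ` J) = X"
    using J by auto
  moreover have "\<forall>i\<in>I. a i \<in> X \<longrightarrow> A i = a i"
    by (auto simp: A_def J_def)
  ultimately show ?thesis by metis
qed

text \<open>Values of \<open>a\<close> and \<open>b\<close> outside \<open>X\<close> cannot collide
  with \<open>c\<close>, so both may be replaced by bijections \<open>A\<close> and \<open>B\<close>
  onto \<open>X\<close>. Labelling \<open>X\<close> through \<open>A\<close> turns \<open>A\<close>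
  into the identity and \<open>B\<close> into a permutation of the indices.\<close>

lemma avoid_two_injections:
  fixes a b :: "nat \<Rightarrow> 'b"
  assumes "finite X" "card X = 4" "inj_on a {..<4}" "inj_on b {..<4}"
  shows "\<exists>c. bij_betw c {..<4} X \<and> (\<forall>i<4. c i \<noteq> a i \<and> c i \<noteq> b i)"
proof -
  obtain A where A: "bij_betw A {..<4} X" "\<forall>i\<in>{..<4}. a i \<in> X \<longrightarrow> A i = a i"
    using extend_injection_to_bijection[of "{..<4::nat}" X a] assms by auto
  obtain B where B: "bij_betw B {..<4} X" "\<forall>i\<in>{..<4}. b i \<in> X \<longrightarrow> B i = b i"
    using extend_injection_to_bijection[of "{..<4::nat}" X b] assms by auto
  let ?b = "inv_into {..<4} A \<circ> B"
  have "bij_betw ?b {..<4} {..<4}"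
    using A(1) B(1) bij_betw_inv_into bij_betw_trans by blast
  then obtain d where d: "bij_betw d {..<4} {..<4}" "\<forall>i<4. d i \<noteq> i \<and> d i \<noteq> ?b i"
    using avoid_id_and_permutation by blast
  have bij: "bij_betw (A \<circ> d) {..<4} X"
    using d(1) A(1) by (rule bij_betw_trans)
  have "(A \<circ> d) i \<noteq> a i \<and> (A \<circ> d) i \<noteq> b i" if "i < 4" for i
  proof -
    have di: "d i \<in> {..<4}" and Ai: "(A \<circ> d) i \<in> X"
      using that d(1) bij by (auto dest: bij_betwE)
    have "A (d i) \<noteq> A i"
      using d(2) that di A(1) by (metis bij_betw_inv_into_left lessThan_iff)
    moreover have "A (d i) \<noteq> B i"
      using d(2) that di A(1) by (metis bij_betw_inv_into_left comp_apply)
    ultimately show ?thesis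
      using A(2) B(2) that Ai by (metis comp_apply lessThan_iff)
  qed
  then show ?thesis using bij by blast
qed

text \<open>Induction on induced subgraphs: delete a vertex \<open>v\<close> of degree at most two,
  pack the rest, then colour \<open>v\<close> avoiding the colour sequences of its
  neighbours.\<close>

lemma two_degenerate_packing:
  assumes "finite V" "k_fold V 4 L" and simple: "\<forall>e\<in>E. e \<subseteq> V \<and> card e = 2"
    and deg: "\<And>T. T \<subseteq> V \<Longrightarrow> T \<noteq> {} \<Longrightarrow> \<exists>v\<in>T. card {u \<in> T. {u, v} \<in> E} \<le> 2"
  shows "\<exists>c. L_packing V E 4 L c"
proof -
  have "\<exists>c. L_packing T {e \<in> E. e \<subseteq> T} 4 L c" if "T \<subseteq> V" for T
    using finite_subset[OF that \<open>finite V\<close>] that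
  proof (induction T rule: finite_psubset_induct)
    case (psubset T)
    show ?case
    proof (cases "T = {}")
      case True
      have "{e \<in> E. e \<subseteq> T} = {}" using simple True by force
      then show ?thesis using True by (simp add: L_packing_def L_coloring_def)
    next
      case False
      then obtain v where v: "v \<in> T" "card {u \<in> T. {u, v} \<in> E} \<le> 2"
        using deg psubset.prems by blast
      have noloop: "{w} \<notin> E" for w using simple by force
      obtain c where c: "L_packing (T - {v}) {e \<in> E. e \<subseteq> T - {v}} 4 L c"
        using psubset.IH[of "T - {v}"] v psubset.prems by blast
      have Lv: "finite (L v)" "card (L v) = 4"
        using assms(2) v psubset.prems by (auto simp: k_fold_def)
      have inj: "inj_on (\<lambda>i. c i u) {..<4}" if "u \<in> T - {v}" for u
        using c that unfolding L_packing_def inj_on_def by blast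
      let ?Nb = "{u \<in> T. {u, v} \<in> E}"
      have Nb: "?Nb \<subseteq> T - {v}" using noloop by auto
      have fin: "finite ?Nb" using psubset.hyps by auto
      \<comment> \<open>With fewer than two neighbours, a dummy vertex pads the pair.\<close>
      obtain u1 u2 where u12: "?Nb \<subseteq> {u1, u2}"
      proof (cases "card ?Nb = 2")
        case True then show ?thesis using that by (metis card_2_iff order_refl)
      next
        case False
        then have "card ?Nb \<le> 1" using v(2) by linarith
        then show ?thesis
          using that[of undefined] that fin unfolding One_nat_def card_le_Suc0_iff_eq[OF fin] by blast
      qed
      \<comment> \<open>A dummy outside \<open>T - {v}\<close> gets the identity, so that there is
        always an injection to avoid; the extra constraint is harmless.\<close>
      define a where "a = (\<lambda>u i. if u \<in> T - {v} then c i u else i)"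
      have "inj_on (a u) {..<4}" for u
        using inj[of u] by (cases "u \<in> T - {v}") (auto simp: a_def inj_on_def)
      then obtain d where d: "bij_betw d {..<4} (L v)" "\<forall>i<4. d i \<noteq> a u1 i \<and> d i \<noteq> a u2 i"
        using avoid_two_injections[OF Lv, of "a u1" "a u2"] by blast
      have dnb: "d i \<noteq> c i u" if "i < 4" "u \<in> ?Nb" for i u
      proof -
        have "u \<in> T - {v}" "u = u1 \<or> u = u2" using that u12 Nb by auto
        then show ?thesis using d(2) that(1) by (auto simp: a_def)
      qed
      define c' where "c' = (\<lambda>i. (c i)(v := d i))"
      have "L_coloring T {e \<in> E. e \<subseteq> T} L (c' i)" if "i < 4" for i
        unfolding L_coloring_def
      proof (intro conjI ballI allI impI)
        fix w assume "w \<in> T"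
        then show "c' i w \<in> L w"
          using c d(1) that by (auto simp: c'_def L_packing_def L_coloring_def dest: bij_betwE)
      next
        fix u w assume uw: "{u, w} \<in> {e \<in> E. e \<subseteq> T}"
        then have "u \<noteq> w" using noloop by auto
        then consider "u = v" "w \<in> ?Nb" "w \<noteq> v" | "w = v" "u \<in> ?Nb" "u \<noteq> v"
          | "u \<noteq> v" "w \<noteq> v" "{u, w} \<in> {e \<in> E. e \<subseteq> T - {v}}"
          using uw by (auto simp: insert_commute)
        then show "c' i u \<noteq> c' i w"
        proof cases
          case 1 then show ?thesis using dnb that by (auto simp: c'_def)
        next
          case 2 then show ?thesis using dnb[of i u] that by (auto simp: c'_def)
        next
          case 3
          then show ?thesis using c that unfolding c'_def L_packing_def L_coloring_def
            by simp
        qed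
      qed
      moreover have "c' i w \<noteq> c' j w" if "w \<in> T" "i < 4" "j < 4" "i \<noteq> j" for w i j
        using c d(1) that unfolding c'_def L_packing_def bij_betw_def inj_on_def by auto
      ultimately have "L_packing T {e \<in> E. e \<subseteq> T} 4 L c'"
        by (auto simp: L_packing_def)
      then show ?thesis by blast
    qed
  qed
  from this[of V] have "\<exists>c. L_packing V {e \<in> E. e \<subseteq> V} 4 L c" by simp
  moreover have "{e \<in> E. e \<subseteq> V} = E" using simple by auto
  ultimately show ?thesis by simp
qed

section \<open>Girth through sets of minimum degree two\<close>

lemma cycle_vertex_two_neighbours:
  assumes cyc: "is_cycle V E cs" and v: "v \<in> set cs"
  obtains u w where "u \<in> set cs" "w \<in> set cs" "u \<noteq> w" "{v, u} \<in> E" "{v, w} \<in> E"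
proof -
  let ?n = "length cs"
  have n: "?n \<ge> 3" and dist: "distinct cs"
    and E: "\<And>i. i < ?n \<Longrightarrow> {cs ! i, cs ! ((i + 1) mod ?n)} \<in> E"
    using cyc by (auto simp: is_cycle_def)
  obtain i where i: "i < ?n" "cs ! i = v" using v by (auto simp: in_set_conv_nth)
  define s where "s = (i + 1) mod ?n"
  \<comment> \<open>\<open>p\<close> and \<open>s\<close> are the cyclic predecessor and successor
    of \<open>i\<close>; they differ because a cycle has at least three vertices.\<close>
  define p where "p = (if i = 0 then ?n - 1 else i - 1)"
  have p: "p < ?n" "(p + 1) mod ?n = i" using n i by (auto simp: p_def)
  have s: "s < ?n" using n unfolding s_def by (intro mod_less_divisor) linarith
  have "s = i + 1 \<or> i = ?n - 1 \<and> s = 0"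
  proof (cases "i + 1 < ?n")
    case False
    then have "i + 1 = ?n" "i = ?n - 1" using i(1) by linarith+
    then show ?thesis by (metis mod_self s_def)
  qed (simp add: s_def)
  then have "p \<noteq> s" using n i by (auto simp: p_def split: if_splits)
  then have "cs ! p \<noteq> cs ! s" using dist p s by (simp add: nth_eq_iff_index_eq)
  moreover have "{v, cs ! s} \<in> E" using E[OF i(1)] i(2) by (simp add: s_def)
  moreover have "{v, cs ! p} \<in> E" using E[OF p(1)] p(2) i(2) by (simp add: insert_commute)
  ultimately show ?thesis using that p s nth_mem by blast
qed

text \<open>Forgetting the cyclic order of a cycle leaves a set in which every vertex has two
  neighbours. Bounding the size of such sets avoids indices modulo the length.\<close>

lemma girth_at_least_if_cores_large:
  assumes "\<And>C. finite C \<Longrightarrow> C \<noteq> {} \<Longrightarrow>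
     (\<forall>v\<in>C. \<exists>u\<in>C. \<exists>w\<in>C. u \<noteq> w \<and> {v, u} \<in> E \<and> {v, w} \<in> E) \<Longrightarrow> g \<le> card C"
  shows "girth_at_least V E g"
  unfolding girth_at_least_def
proof (intro allI impI)
  fix cs assume cyc: "is_cycle V E cs"
  have "g \<le> card (set cs)"
  proof (rule assms)
    show "set cs \<noteq> {}" using cyc by (auto simp: is_cycle_def)
    show "\<forall>v\<in>set cs. \<exists>u\<in>set cs. \<exists>w\<in>set cs. u \<noteq> w \<and> {v, u} \<in> E \<and> {v, w} \<in> E"
      by (rule ballI, rule cycle_vertex_two_neighbours[OF cyc]) blast+
  qed simp
  then show "g \<le> length cs" using cyc by (simp add: is_cycle_def distinct_card)
qed

section \<open>Relabelling vertices along an injection\<close>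

lemma list_packing_number_image:
  assumes inj: "inj_on f V" and simple: "\<forall>e\<in>E. e \<subseteq> V \<and> card e = 2"
  shows "list_packing_number (f ` V) ((`) f ` E) = list_packing_number V E"
proof -
  let ?h = "inv_into V f"
  have h: "?h (f v) = v" if "v \<in> V" for v using inj that by simp
  have edge: "{u, v} \<in> (`) f ` E \<longleftrightarrow> (\<exists>u' v'. u = f u' \<and> v = f v' \<and> {u', v'} \<in> E)" for u v
  proof
    assume "{u, v} \<in> (`) f ` E"
    then obtain e where e: "e \<in> E" "{u, v} = f ` e" by auto
    then obtain a b where ab: "e = {a, b}" using simple by (meson card_2_iff)
    then have "u = f a \<and> v = f b \<or> u = f b \<and> v = f a"
      using e(2) by (simp add: doubleton_eq_iff)
    moreover have "{a, b} \<in> E" "{b, a} \<in> E"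
      using e(1) ab by (simp_all add: insert_commute)
    ultimately show "\<exists>u' v'. u = f u' \<and> v = f v' \<and> {u', v'} \<in> E"
      by blast
  next
    assume "\<exists>u' v'. u = f u' \<and> v = f v' \<and> {u', v'} \<in> E"
    then obtain u' v' where "u = f u'" "v = f v'" "{u', v'} \<in> E" by blast
    then show "{u, v} \<in> (`) f ` E" using imageI[of "{u', v'}" E "(`) f"] by simp
  qed
  have EV: "u \<in> V" "v \<in> V" if "{u, v} \<in> E" for u v using simple that by (metis insert_subset)+
  \<comment> \<open>Lists and packings travel along \<open>f\<close> one way and along its inverse
    \<open>?h\<close> the other way, so the same \<open>k\<close> are admissible for both
    graphs.\<close>
  have "(\<forall>L. k_fold (f ` V) k L \<longrightarrow> (\<exists>c. L_packing (f ` V) ((`) f ` E) k L c)) \<longleftrightarrow>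
        (\<forall>L. k_fold V k L \<longrightarrow> (\<exists>c. L_packing V E k L c))" for k
  proof (intro iffI allI impI)
    fix L assume *: "\<forall>L. k_fold (f ` V) k L \<longrightarrow> (\<exists>c. L_packing (f ` V) ((`) f ` E) k L c)"
      and L: "k_fold V k L"
    have "k_fold (f ` V) k (L \<circ> ?h)" using L by (auto simp: k_fold_def h)
    then obtain c where "L_packing (f ` V) ((`) f ` E) k (L \<circ> ?h) c" using * by blast
    then have "L_packing V E k L (\<lambda>i. c i \<circ> f)"
      unfolding L_packing_def L_coloring_def edge by (simp add: h) blast
    then show "\<exists>c. L_packing V E k L c" by blast
  next
    fix L assume *: "\<forall>L. k_fold V k L \<longrightarrow> (\<exists>c. L_packing V E k L c)"
      and L: "k_fold (f ` V) k L"
    have "k_fold V k (L \<circ> f)" using L by (auto simp: k_fold_def)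
    then obtain c where "L_packing V E k (L \<circ> f) c" using * by blast
    then have "L_packing (f ` V) ((`) f ` E) k L (\<lambda>i. c i \<circ> ?h)"
      unfolding L_packing_def L_coloring_def edge using EV by (auto simp: h)
    then show "\<exists>c. L_packing (f ` V) ((`) f ` E) k L c" by blast
  qed
  then show ?thesis by (simp add: list_packing_number_def)
qed

text \<open>The drawing stays as it is; points and arcs are merely looked up through
  \<open>inv f\<close>.\<close>

lemma planar_graph_image:
  assumes inj: "inj f" and planar: "planar_graph V E"
  shows "planar_graph (f ` V) ((`) f ` E)"
proof -
  obtain p :: "_ \<Rightarrow> complex" and \<gamma> :: "_ \<Rightarrow> real \<Rightarrow> complex" where p: "inj_on p V"
    and \<gamma>: "\<forall>e\<in>E. arc (\<gamma> e) \<and> {pathstart (\<gamma> e), pathfinish (\<gamma> e)} = p ` e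
                 \<and> path_image (\<gamma> e) \<inter> p ` V = p ` e"
    and disj: "\<forall>e\<in>E. \<forall>e'\<in>E. e \<noteq> e' \<longrightarrow>
                 path_image (\<gamma> e) \<inter> path_image (\<gamma> e') \<subseteq> p ` (e \<inter> e')"
    using planar unfolding planar_graph_def by (elim exE conjE) (rule that)
  define q where "q = p \<circ> inv f"
  have q: "q ` f ` A = p ` A" and inv: "inv f ` f ` A = A" for A
    using inj by (simp_all add: q_def image_image)
  have "q (f x) = p x" for x using inj by (simp add: q_def)
  then have "inj_on q (f ` V)" using p by (auto simp: inj_on_def)
  moreover have "arc (\<gamma> (inv f ` e)) \<and>
      {pathstart (\<gamma> (inv f ` e)), pathfinish (\<gamma> (inv f ` e))} = q ` e \<and>
      path_image (\<gamma> (inv f ` e)) \<inter> q ` f ` V = q ` e" if e: "e \<in> (`) f ` E" for e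
  proof -
    obtain d where "d \<in> E" "e = f ` d" using e by blast
    then show ?thesis using \<gamma> by (simp only: q inv)
  qed
  moreover have "path_image (\<gamma> (inv f ` e)) \<inter> path_image (\<gamma> (inv f ` e')) \<subseteq> q ` (e \<inter> e')"
    if ee': "e \<in> (`) f ` E" "e' \<in> (`) f ` E" "e \<noteq> e'" for e e'
  proof -
    obtain d d' where "d \<in> E" "d' \<in> E" "d \<noteq> d'" "e = f ` d" "e' = f ` d'"
      using ee' by blast
    then show ?thesis using disj by (simp only: q inv image_Int[OF inj, symmetric] simp_thms)
  qed
  ultimately show ?thesis unfolding planar_graph_def
    by (intro exI[of _ q] exI[of _ "\<lambda>e. \<gamma> (inv f ` e)"] conjI ballI impI) simp_all
qed

lemma girth_at_least_image:
  assumes inj: "inj f" and girth: "girth_at_least V E g"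
  shows "girth_at_least (f ` V) ((`) f ` E) g"
  unfolding girth_at_least_def
proof (intro allI impI)
  fix cs assume cyc: "is_cycle (f ` V) ((`) f ` E) cs"
  define ds where "ds = map (inv f) cs"
  have "set cs \<subseteq> range f" using cyc unfolding is_cycle_def by blast
  then have cs: "cs = map f ds" by (simp add: ds_def map_idI f_inv_into_f subset_iff)
  have len: "length ds = length cs" by (simp add: ds_def)
  have "is_cycle V E ds"
    unfolding is_cycle_def
  proof (intro conjI allI impI)
    show "3 \<le> length ds" using cyc by (simp add: is_cycle_def len)
    show "distinct ds" using cyc by (simp add: is_cycle_def cs distinct_map)
    have "f ` set ds \<subseteq> f ` V" using cyc by (simp add: is_cycle_def cs)
    then show "set ds \<subseteq> V" using inj by (simp add: inj_image_subset_iff)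
    fix i assume i: "i < length ds"
    let ?j = "(i + 1) mod length ds"
    have j: "?j < length ds" using i by (intro mod_less_divisor) linarith
    have "{cs ! i, cs ! ((i + 1) mod length cs)} \<in> (`) f ` E"
      using cyc i len unfolding is_cycle_def by metis
    then have "{f (ds ! i), f (ds ! ?j)} \<in> (`) f ` E" using i j by (simp add: cs)
    then have "f ` {ds ! i, ds ! ?j} \<in> (`) f ` E" by simp
    then obtain e where "e \<in> E" "f ` {ds ! i, ds ! ?j} = f ` e" by blast
    then show "{ds ! i, ds ! ?j} \<in> E" using inj_image_eq_iff[OF inj] by metis
  qed
  then show "g \<le> length cs" using girth len unfolding girth_at_least_def by metis
qed

section \<open>Plane drawings with arcs confined to regions\<close>

lemma arc_join3_linepath:
  fixes a b c d :: "'a::euclidean_space"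
  assumes "a \<noteq> b" "b \<noteq> c" "c \<noteq> d"
    and "closed_segment a b \<inter> closed_segment b c \<subseteq> {b}" "closed_segment b c \<inter> closed_segment c d \<subseteq> {c}"
    and "closed_segment a b \<inter> closed_segment c d = {}"
  shows "arc (linepath a b +++ linepath b c +++ linepath c d)"
proof -
  have "arc (linepath b c +++ linepath c d)"
    using assms by (intro arc_join) auto
  then show ?thesis
    using assms by (intro arc_join) (auto simp: path_image_join)
qed

text \<open>Each arc lies inside its region \<open>K e\<close>, so crossings need only be excluded
  for regions, which can be given by inequalities instead of parametrised curves.\<close>

lemma planar_graph_by_regions:
  fixes p :: "'a \<Rightarrow> complex" and K :: "'a set \<Rightarrow> complex set"
  assumes "inj_on p V"
    and arcs: "\<And>e. e \<in> E \<Longrightarrow> e \<subseteq> V \<and> (\<exists>\<gamma>. arc \<gamma> \<and> {pathstart \<gamma>, pathfinish \<gamma>} = p ` e \<and> path_image \<gamma> \<subseteq> K e)"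
    and vertex: "\<And>e v. e \<in> E \<Longrightarrow> v \<in> V \<Longrightarrow> p v \<in> K e \<Longrightarrow> v \<in> e"
    and cross: "\<And>e e' z. e \<in> E \<Longrightarrow> e' \<in> E \<Longrightarrow> e \<noteq> e' \<Longrightarrow> z \<in> K e \<Longrightarrow> z \<in> K e' \<Longrightarrow> z \<in> p ` (e \<inter> e')"
  shows "planar_graph V E"
proof -
  have "\<forall>e\<in>E. \<exists>\<gamma>. arc \<gamma> \<and> {pathstart \<gamma>, pathfinish \<gamma>} = p ` e \<and> path_image \<gamma> \<subseteq> K e"
    by (rule ballI, drule arcs, erule conjunct2)
  from bchoice[OF this] obtain \<gamma> where \<gamma>: "\<And>e. e \<in> E \<Longrightarrow>
      arc (\<gamma> e) \<and> {pathstart (\<gamma> e), pathfinish (\<gamma> e)} = p ` e \<and> path_image (\<gamma> e) \<subseteq> K e"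
    by blast
  have "path_image (\<gamma> e) \<inter> p ` V = p ` e" if "e \<in> E" for e
  proof
    show "path_image (\<gamma> e) \<inter> p ` V \<subseteq> p ` e" using \<gamma>[OF that] vertex[OF that] by blast
    have "p ` e \<subseteq> path_image (\<gamma> e)"
      using \<gamma>[OF that] by (metis insert_subset empty_subsetI pathstart_in_path_image pathfinish_in_path_image)
    moreover have "p ` e \<subseteq> p ` V" using arcs[OF that] by (intro image_mono) (erule conjunct1)
    ultimately show "p ` e \<subseteq> path_image (\<gamma> e) \<inter> p ` V" by (rule Int_greatest)
  qed
  moreover have "path_image (\<gamma> e) \<inter> path_image (\<gamma> e') \<subseteq> p ` (e \<inter> e')"
    if "e \<in> E" "e' \<in> E" "e \<noteq> e'" for e e'
  proof (rule subsetI)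
    fix z assume "z \<in> path_image (\<gamma> e) \<inter> path_image (\<gamma> e')"
    then have "z \<in> K e" "z \<in> K e'" using \<gamma>[OF that(1)] \<gamma>[OF that(2)] by auto
    then show "z \<in> p ` (e \<inter> e')" by (rule cross[OF that])
  qed
  ultimately show ?thesis
    unfolding planar_graph_def using assms(1) \<gamma>
    by (intro exI[of _ p] exI[of _ \<gamma>] conjI ballI impI) simp_all
qed

section \<open>Orientations of packed lists of size three\<close>

definition word :: "(nat \<Rightarrow> 'v \<Rightarrow> nat) \<Rightarrow> 'v \<Rightarrow> nat \<times> nat \<times> nat" where
  "word c v = (c 0 v, c 1 v, c 2 v)"

text \<open>The rotations of a triple with distinct entries are its even rearrangements, so this is
  the orientation bit relative to a reference triple.\<close>

definition oriented :: "nat \<times> nat \<times> nat \<Rightarrow> nat \<times> nat \<times> nat \<Rightarrow> bool" where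
  "oriented t w \<longleftrightarrow> (case t of (a, b, x) \<Rightarrow> w = (a, b, x) \<or> w = (b, x, a) \<or> w = (x, a, b))"

lemma oriented_rotate: "oriented (a, b, x) w \<longleftrightarrow> oriented (b, x, a) w"
  unfolding oriented_def prod.case by blast

text \<open>Of the six orders of the list, three are rotations of \<open>(a, b, x)\<close> and three
  of \<open>(b, a, x)\<close>.\<close>

lemma L_packing_word:
  assumes "L_packing V E 3 L c" "v \<in> V" "L v = {a, b, x}"
  shows "oriented (a, b, x) (word c v) \<or> oriented (b, a, x) (word c v)"
proof -
  have "c i v \<in> {a, b, x}" if "i < 3" for i
    using assms that unfolding L_packing_def L_coloring_def by blast
  from this[of 0] this[of 1] this[of 2]
  have "c 0 v = a \<or> c 0 v = b \<or> c 0 v = x" "c 1 v = a \<or> c 1 v = b \<or> c 1 v = x"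
    "c 2 v = a \<or> c 2 v = b \<or> c 2 v = x"
    by simp_all
  moreover have "c i v \<noteq> c j v" if "i < 3" "j < 3" "i \<noteq> j" for i j
    using assms(1,2) that unfolding L_packing_def by blast
  from this[of 0 1] this[of 0 2] this[of 1 2]
  have "c 0 v \<noteq> c 1 v" "c 0 v \<noteq> c 2 v" "c 1 v \<noteq> c 2 v" by simp_all
  ultimately show ?thesis unfolding oriented_def word_def prod.case prod.inject by metis
qed

lemma L_packing_edge:
  assumes "L_packing V E k L c" "i < k" "{u, v} \<in> E"
  shows "c i u \<noteq> c i v"
  using assms by (auto simp: L_packing_def L_coloring_def)

text \<open>An even and an odd arrangement of three entries differ by a transposition, which fixes
  one position.\<close>

lemma opposite_words_agree_somewhere:
  assumes "oriented (a, b, x) (word c u)" "oriented (b, a, x) (word c v)"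
  shows "c 0 u = c 0 v \<or> c 1 u = c 1 v \<or> c 2 u = c 2 v"
  using assms unfolding oriented_def word_def prod.case prod.inject by (elim disjE conjE) simp_all

text \<open>Adjacent words differ in every position, so by the preceding lemma they cannot be
  oppositely oriented.\<close>

lemma oriented_same_list:
  assumes "L_packing V E 3 L c" "u \<in> V" "v \<in> V" "{u, v} \<in> E"
    and "L u = {a, b, x}" "L v = {a, b, x}" "distinct [a, b, x]"
  shows "oriented (a, b, x) (word c u) \<longleftrightarrow> oriented (a, b, x) (word c v)"
proof -
  have "c 0 u \<noteq> c 0 v" "c 1 u \<noteq> c 1 v" "c 2 u \<noteq> c 2 v"
    using L_packing_edge[OF assms(1) _ assms(4)] by simp_all
  then show ?thesis
    using L_packing_word[OF assms(1,2,5)] L_packing_word[OF assms(1,3,6)] assms(7)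
      opposite_words_agree_somewhere[of a b x c u v] opposite_words_agree_somewhere[of a b x c v u]
    by metis
qed

text \<open>With \<open>x\<close> and \<open>y\<close> identified, the words differ by a
  transposition and agree in exactly one position. Actual colours never agree, so that position
  holds \<open>x\<close> against \<open>y\<close>, while \<open>a\<close> and \<open>b\<close> are
  exchanged.\<close>

lemma opposite_orientation_forces:
  assumes "distinct [a, b, x, y]" "oriented (a, b, x) (word c u)" "oriented (b, a, y) (word c v)"
    and "\<And>i. i < 3 \<Longrightarrow> c i u \<noteq> c i v"
  shows "c 0 v = (if c 0 u = a then b else if c 0 u = b then a else y)"
proof -
  have "c 0 u \<noteq> c 0 v" "c 1 u \<noteq> c 1 v" "c 2 u \<noteq> c 2 v" using assms(4) by simp_all
  then show ?thesis using assms(1-3) unfolding oriented_def word_def prod.case prod.inject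
    by (elim disjE conjE) simp_all
qed

lemma oriented_first:
  assumes "oriented (a, b, x) (word c u)" shows "c 0 u \<in> {a, b, x}"
  using assms by (auto simp: oriented_def word_def)

text \<open>Two consecutive steps undo each other's exchange, so the first colour is the same at all
  even positions, in particular at both ends of the closing edge.\<close>

lemma odd_cycle_orientation:
  fixes s :: "nat \<Rightarrow> 'v"
  assumes "L_packing V E 3 L c" and "distinct [a, b, x, y]"
    and path: "\<And>i. i < 2 * m \<Longrightarrow> {s i, s (Suc i)} \<in> E" and closing: "{s 0, s (2 * m)} \<in> E"
    and ev: "\<And>i. i \<le> m \<Longrightarrow> oriented (a, b, x) (word c (s (2 * i)))"
    and od: "\<And>i. i < m \<Longrightarrow> oriented (b, a, y) (word c (s (2 * i + 1)))"
  shows False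
proof -
  have "c 0 (s (2 * i)) = c 0 (s 0)" if "i \<le> m" for i
    using that
  proof (induction i)
    case (Suc i)
    have e: "{s (2 * i), s (2 * i + 1)} \<in> E" "{s (2 * Suc i), s (2 * i + 1)} \<in> E"
      using path[of "2 * i"] path[of "2 * i + 1"] Suc.prems by (auto simp: insert_commute)
    have "c 0 (s (2 * i + 1)) = (if c 0 u = a then b else if c 0 u = b then a else y)"
      if "u \<in> {s (2 * i), s (2 * Suc i)}" for u
      using that opposite_orientation_forces[OF assms(2), of c u "s (2 * i + 1)"] ev[of i] ev[of "Suc i"] od[of i] e
        L_packing_edge[OF assms(1)] Suc.prems by (cases "u = s (2 * i)") auto
    from this[of "s (2 * i)"] this[of "s (2 * Suc i)"]
    have "c 0 (s (2 * i)) = c 0 (s (2 * Suc i))"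
      using oriented_first[OF ev[of i]] oriented_first[OF ev[of "Suc i"]] assms(2) Suc.prems
      by (auto split: if_splits)
    then show ?case using Suc by simp
  qed simp
  then have "c 0 (s (2 * m)) = c 0 (s 0)" by blast
  then show False using L_packing_edge[OF assms(1) _ closing, of 0] by simp
qed

text \<open>An odd cycle has no proper colouring with two colours; \<open>1 \<le> k\<close> supplies
  the colouring \<open>c 0\<close>.\<close>

lemma odd_cycle_two_colours:
  fixes s :: "nat \<Rightarrow> 'v"
  assumes path: "\<And>i. i < 2 * m \<Longrightarrow> {s i, s (Suc i)} \<in> E" and closing: "{s 0, s (2 * m)} \<in> E"
    and V: "\<And>i. i \<le> 2 * m \<Longrightarrow> s i \<in> V" and k: "1 \<le> k" "k \<le> 2"
  shows "\<not> L_packing V E k (\<lambda>_. {..<k}) c"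
proof
  assume p: "L_packing V E k (\<lambda>_. {..<k}) c"
  have col: "c 0 (s i) \<in> {0, 1}" if "i \<le> 2 * m" for i
    using p k V[OF that] by (force simp: L_packing_def L_coloring_def)
  have "c 0 (s (2 * i)) = c 0 (s 0)" if "i \<le> m" for i
    using that
  proof (induction i)
    case (Suc i)
    have "c 0 (s (2 * i)) \<noteq> c 0 (s (2 * i + 1))" "c 0 (s (2 * i + 1)) \<noteq> c 0 (s (2 * Suc i))"
      using path[of "2 * i"] path[of "2 * i + 1"] Suc.prems L_packing_edge[OF p, of 0] k by auto
    then have "c 0 (s (2 * i)) = c 0 (s (2 * Suc i))"
      using col[of "2 * i"] col[of "2 * i + 1"] col[of "2 * Suc i"] Suc.prems by auto
    then show ?case using Suc by simp
  qed simp
  then have "c 0 (s (2 * m)) = c 0 (s 0)" by blast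
  then show False using L_packing_edge[OF p _ closing, of 0] k by simp
qed

section \<open>The lattice graph\<close>

text \<open>\<open>N\<close> is the length of a block, \<open>h\<close> the distance between
  consecutive rows. Evenness of \<open>N\<close> makes a block with its closing edge an odd cycle;
  large values of both give large girth.\<close>

locale lattice_graph =
  fixes N h :: int
  assumes N: "even N" "N \<ge> 2" and h: "h \<ge> 2"
begin

text \<open>
  The three cycles run along the \<open>x\<close>-axis over the blocks \<open>[s, s + N]\<close> with \<open>s \<in> starts\<close>; each is closed by
  an edge from \<open>(s, 0)\<close> to \<open>(s + N, 0)\<close>. From the even points of a block, teeth lead up to a row at
  height \<open>h\<close>, below the closing edge; from the odd points, teeth lead down to height \<open>- h\<close>. The combs are
  joined by the row at height \<open>- h\<close> and, through the columns at \<open>-2\<close>, \<open>2 * N + 8\<close> and \<open>3 * N + 14\<close>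
  reached from outer ends of the blocks, by the row at height \<open>- 2 * h\<close>. Even and odd points carry the lists
  \<open>A, B\<close> in the first block, \<open>C, B\<close> in the second and \<open>A, C\<close> in the third.
\<close>
definition starts :: "int set" where
  "starts = {0, N + 6, 2 * N + 12}"

definition in_block :: "int \<Rightarrow> bool" where
  "in_block x \<longleftrightarrow> (\<exists>s\<in>starts. s \<le> x \<and> x \<le> s + N)"

text \<open>Row \<open>- h\<close> falls into pieces: one joins the odd teeth of the first two
  blocks, another joins those of the third block to the column at \<open>2 * N + 8\<close>;
  \<open>-2\<close> and \<open>3 * N + 14\<close> are points of the outer columns.\<close>

definition S :: "(int \<times> int) set" where
  "S = {(x, y).
     y = 0 \<and> (in_block x \<or> x \<in> {-2, -1, 2 * N + 7, 2 * N + 8, 3 * N + 13, 3 * N + 14}) \<or>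
     0 < y \<and> y < h \<and> even x \<and> in_block x \<or>
     y = h \<and> in_block x \<or>
     - h < y \<and> y < 0 \<and> (odd x \<and> in_block x \<or> x \<in> {-2, 2 * N + 8, 3 * N + 14}) \<or>
     y = - h \<and> (1 \<le> x \<and> x \<le> 2 * N + 5 \<or> 2 * N + 8 \<le> x \<and> x \<le> 3 * N + 11 \<or> x \<in> {-2, 3 * N + 14}) \<or>
     - 2 * h < y \<and> y < - h \<and> x \<in> {-2, 3 * N + 14} \<or>
     y = - 2 * h \<and> -2 \<le> x \<and> x \<le> 3 * N + 14}"

text \<open>Steps go in increasing direction only, so each edge has one of three types. Apart from
  the closing edges, the graph is the grid induced on \<open>S\<close>.\<close>

definition step :: "int \<times> int \<Rightarrow> int \<times> int \<Rightarrow> bool" where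
  "step u v \<longleftrightarrow> v = (fst u + 1, snd u) \<or> v = (fst u, snd u + 1) \<or>
     snd u = 0 \<and> fst u \<in> starts \<and> v = (fst u + N, 0)"

definition E :: "(int \<times> int) set set" where
  "E = {{u, v} |u v. u \<in> S \<and> v \<in> S \<and> step u v}"

lemma in_block_iff:
  "in_block x \<longleftrightarrow> 0 \<le> x \<and> x \<le> N \<or> N + 6 \<le> x \<and> x \<le> 2 * N + 6 \<or> 2 * N + 12 \<le> x \<and> x \<le> 3 * N + 12"
  by (auto simp: in_block_def starts_def)

lemma S_iff:
  "(x, y) \<in> S \<longleftrightarrow>
     y = 0 \<and> (in_block x \<or> x \<in> {-2, -1, 2 * N + 7, 2 * N + 8, 3 * N + 13, 3 * N + 14}) \<or>
     0 < y \<and> y < h \<and> even x \<and> in_block x \<or>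
     y = h \<and> in_block x \<or>
     - h < y \<and> y < 0 \<and> (odd x \<and> in_block x \<or> x \<in> {-2, 2 * N + 8, 3 * N + 14}) \<or>
     y = - h \<and> (1 \<le> x \<and> x \<le> 2 * N + 5 \<or> 2 * N + 8 \<le> x \<and> x \<le> 3 * N + 11 \<or> x \<in> {-2, 3 * N + 14}) \<or>
     - 2 * h < y \<and> y < - h \<and> x \<in> {-2, 3 * N + 14} \<or>
     y = - 2 * h \<and> -2 \<le> x \<and> x \<le> 3 * N + 14"
  by (simp add: S_def)

lemma edge_iff: "{u, v} \<in> E \<longleftrightarrow> u \<in> S \<and> v \<in> S \<and> (step u v \<or> step v u)"
  unfolding E_def mem_Collect_eq doubleton_eq_iff by blast

lemma step_irrefl: "\<not> step u u"
  using N(2) by (cases u) (auto simp: step_def)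

lemma S_bounds:
  assumes "(x, y) \<in> S" shows "-2 \<le> x" "x \<le> 3 * N + 14" "- 2 * h \<le> y" "y \<le> h"
  using assms N(2) h unfolding S_iff in_block_iff insert_iff empty_iff simp_thms
  by (elim disjE conjE; linarith)+

lemma finite_S: "finite S"
proof (rule finite_subset)
  show "S \<subseteq> {-2..3 * N + 14} \<times> {- 2 * h..h}" using S_bounds by auto
qed simp

lemma simple_E: "\<forall>e\<in>E. e \<subseteq> S \<and> card e = 2"
proof
  fix e assume "e \<in> E"
  then obtain u v where uv: "e = {u, v}" "u \<in> S" "v \<in> S" "step u v" by (auto simp: E_def)
  then have "u \<noteq> v" using step_irrefl by blast
  then show "e \<subseteq> S \<and> card e = 2" using uv by simp
qed

section \<open>Degrees and cycles in the lattice graph\<close>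

definition levels :: "int set" where
  "levels = {h, 0, - h, - 2 * h}"

text \<open>Between rows, occupied abscissae are never consecutive: above the axis they are even;
  below it they are odd points of blocks or the three column positions, which keep distance two from
  the blocks.\<close>

lemma column_interior_neighbours:
  assumes y: "y \<notin> levels" and e: "{(x, y), u} \<in> E"
  shows "u = (x, y + 1) \<or> u = (x, y - 1)"
proof -
  obtain x' y' where u: "u = (x', y')" by (cases u)
  have S: "(x, y) \<in> S" "(x', y') \<in> S" and st: "step (x, y) (x', y') \<or> step (x', y') (x, y)"
    using e unfolding edge_iff u by auto
  have shape: "0 < y \<and> even z \<or> y < 0 \<and> odd z \<and> in_block z \<or> y < 0 \<and> z \<in> {-2, 2 * N + 8, 3 * N + 14}"
    if "(z, y) \<in> S" for z
    using that y h unfolding S_iff levels_def insert_iff empty_iff by (elim disjE conjE) simp_all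
  have no: "(z, y) \<notin> S \<or> (z + 1, y) \<notin> S" for z
  proof (rule ccontr)
    assume "\<not> ?thesis"
    then have S: "(z, y) \<in> S" "(z + 1, y) \<in> S" by auto
    have "odd (z + 1) \<longleftrightarrow> even z" by simp
    moreover have "\<not> in_block z" if "z + 1 \<in> {-2, 2 * N + 8, 3 * N + 14}"
      using that N(2) unfolding in_block_iff insert_iff empty_iff by smt
    moreover have "\<not> in_block (z + 1) \<and> z + 1 \<notin> {-2, 2 * N + 8, 3 * N + 14}" if "z \<in> {-2, 2 * N + 8, 3 * N + 14}"
      using that N(2) unfolding in_block_iff insert_iff empty_iff by smt
    ultimately show False using shape[OF S(1)] shape[OF S(2)] by smt
  qed
  from st have "y' = y \<and> (x' = x + 1 \<or> x = x' + 1) \<or> x' = x \<and> (y' = y + 1 \<or> y = y' + 1)"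
    using y unfolding step_def levels_def by auto
  moreover have "\<not> (y' = y \<and> x' = x + 1)" "\<not> (y' = y \<and> x = x' + 1)"
    using no[of x] no[of x'] S by blast+
  ultimately show ?thesis unfolding u by force
qed

lemma row_neighbours:
  assumes "y \<in> levels" "y' \<in> levels" and e: "{(x, y), (x', y')} \<in> E"
  shows "y' = y \<and> (x' = x + 1 \<or> x = x' + 1 \<or> y = 0 \<and> (x \<in> starts \<and> x' = x + N \<or> x' \<in> starts \<and> x = x' + N))"
proof -
  have st: "step (x, y) (x', y') \<or> step (x', y') (x, y)"
    using e unfolding edge_iff by auto
  have "y' \<noteq> y + 1" "y \<noteq> y' + 1" using assms(1,2) h unfolding levels_def by auto
  then show ?thesis using st unfolding step_def by auto
qed

text \<open>A vertex between rows has only its two vertical neighbours. If \<open>T\<close> lies in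
  the rows, its leftmost vertex can only have the neighbours \<open>1\<close> and \<open>N\<close>
  to the right.\<close>

lemma two_degenerate:
  assumes T: "T \<subseteq> S" "T \<noteq> {}"
  shows "\<exists>v\<in>T. card {u \<in> T. {u, v} \<in> E} \<le> 2"
proof (cases "\<exists>v\<in>T. snd v \<notin> levels")
  case True
  then obtain x y where v: "(x, y) \<in> T" "y \<notin> levels" by auto
  have "{u \<in> T. {u, (x, y)} \<in> E} \<subseteq> {(x, y + 1), (x, y - 1)}"
    using column_interior_neighbours[OF v(2)] by (auto simp: insert_commute)
  then have "card {u \<in> T. {u, (x, y)} \<in> E} \<le> card {(x, y + 1), (x, y - 1)}"
    by (intro card_mono) auto
  also have "\<dots> \<le> 2" by (simp add: card_insert_if)
  finally show ?thesis using v(1) by blast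
next
  case False
  have "finite T" using T(1) finite_S by (rule finite_subset)
  then obtain v where v: "v \<in> T" "\<forall>u\<in>T. fst v \<le> fst u"
    using T(2) by (meson arg_min_if_finite(1) arg_min_least)
  obtain x y where xy: "v = (x, y)" by (cases v)
  have "{u \<in> T. {u, v} \<in> E} \<subseteq> {(x + 1, y), (x + N, y)}"
  proof
    fix u assume u: "u \<in> {u \<in> T. {u, v} \<in> E}"
    obtain x' y' where u': "u = (x', y')" by (cases u)
    have "x \<le> x'" using u v xy u' by auto
    moreover have "{(x, y), (x', y')} \<in> E" using u u' xy by (simp add: insert_commute)
    moreover have "y \<in> levels" "y' \<in> levels" using False u v u' xy by auto
    ultimately show "u \<in> {(x + 1, y), (x + N, y)}"
      using row_neighbours[of y y' x x'] N(2) u' by auto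
  qed
  then have "card {u \<in> T. {u, v} \<in> E} \<le> card {(x + 1, y), (x + N, y)}"
    by (intro card_mono) auto
  also have "\<dots> \<le> 2" by (simp add: card_insert_if)
  finally show ?thesis using v by blast
qed

text \<open>The same two cases: a vertex between rows forces its whole column segment of
  \<open>h - 1\<close> vertices into \<open>C\<close>; otherwise the leftmost vertex must start a
  block, and the two-neighbour condition propagates along that block.\<close>

lemma core_large:
  assumes "finite C" "C \<noteq> {}"
    and core: "\<forall>v\<in>C. \<exists>u\<in>C. \<exists>w\<in>C. u \<noteq> w \<and> {v, u} \<in> E \<and> {v, w} \<in> E"
  shows "min (h - 1) (N + 1) \<le> int (card C)"
proof (cases "\<exists>v\<in>C. snd v \<notin> levels")
  case True
  then obtain x y where v: "(x, y) \<in> C" "y \<notin> levels" by auto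
  have "(x, y) \<in> S" using core v(1) edge_iff by blast
  then have "- 2 * h \<le> y" "y \<le> h" using S_bounds by auto
  \<comment> \<open>\<open>l\<close> is the height of the row just below \<open>y\<close>.\<close>
  then obtain l where l: "l \<in> {0, - h, - 2 * h}" "l < y" "y < l + h"
  proof -
    have "y \<noteq> h" "y \<noteq> 0" "y \<noteq> - h" "y \<noteq> - 2 * h" using v(2) by (auto simp: levels_def)
    then consider "0 < y" "y < h" | "- h < y" "y < 0" | "- 2 * h < y" "y < - h"
      using \<open>- 2 * h \<le> y\<close> \<open>y \<le> h\<close> by linarith
    then show ?thesis by cases (use that[of 0] that[of "- h"] that[of "- 2 * h"] in simp_all)
  qed
  have both: "(x, j + 1) \<in> C \<and> (x, j - 1) \<in> C" if j: "l < j" "j < l + h" "(x, j) \<in> C" for j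
  proof -
    have "j \<notin> levels" using j l(1) unfolding levels_def by auto
    then have "u = (x, j + 1) \<or> u = (x, j - 1)" if "{(x, j), u} \<in> E" for u
      using column_interior_neighbours that by blast
    then show ?thesis using bspec[OF core j(3)] by metis
  qed
  have up: "j < l + h \<longrightarrow> (x, j) \<in> C" if "y \<le> j" for j
    using that
  proof (induction j rule: int_ge_induct)
    case (step i) then show ?case using both[of i] l by auto
  qed (use v in auto)
  have down: "l < j \<longrightarrow> (x, j) \<in> C" if "j \<le> y" for j
    using that
  proof (induction j rule: int_le_induct)
    case (step i) then show ?case using both[of i] l by auto
  qed (use v in auto)
  have "Pair x ` {l<..<l + h} \<subseteq> C" using up down by (metis greaterThanLessThan_iff image_subsetI linear)
  then have "card (Pair x ` {l<..<l + h}) \<le> card C" using assms(1) by (rule card_mono[rotated])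
  moreover have "card (Pair x ` {l<..<l + h}) = nat (h - 1)" by (subst card_image) (auto simp: inj_on_def)
  ultimately show ?thesis using h by linarith
next
  case False
  obtain v where v: "v \<in> C" "\<forall>u\<in>C. fst v \<le> fst u"
    using assms(1,2) by (meson arg_min_if_finite(1) arg_min_least)
  obtain s y where sy: "v = (s, y)" by (cases v)
  have lev: "y' \<in> levels" if "(x', y') \<in> C" for x' y' using False that by auto
  have nb: "u = (s + 1, y) \<or> y = 0 \<and> s \<in> starts \<and> u = (s + N, 0)" if "u \<in> C" "{v, u} \<in> E" for u
  proof -
    obtain x' y' where u: "u = (x', y')" by (cases u)
    have "s \<le> x'" using v(2) that(1) sy u by auto
    then show ?thesis
      using row_neighbours[of y y' s x'] lev that v(1) N(2) unfolding sy u by auto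
  qed
  then have s: "y = 0" "s \<in> starts" and s1: "(s + 1, 0) \<in> C"
    using bspec[OF core v(1)] by metis+
  have inC: "i \<le> N \<longrightarrow> (s + i, 0) \<in> C" if "1 \<le> i" for i
    using that
  proof (induction i rule: int_ge_induct)
    case (step i)
    show ?case
    proof
      assume i: "i + 1 \<le> N"
      then have C: "(s + i, 0) \<in> C" using step by simp
      \<comment> \<open>No closing edge is attached inside a block, so only the left and right
        neighbours remain.\<close>
      have nonst: "s + i \<notin> starts" "s + i - N \<notin> starts"
        using s(2) i step.hyps unfolding starts_def by auto
      have "u = (s + i + 1, 0) \<or> u = (s + i - 1, 0)" if "u \<in> C" "{(s + i, 0), u} \<in> E" for u
      proof -
        obtain x' y' where u: "u = (x', y')" by (cases u)
        have "x' \<in> starts \<Longrightarrow> s + i \<noteq> x' + N" using nonst(2) by auto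
        then show ?thesis
          using row_neighbours[of 0 y' "s + i" x'] lev[of "s + i" 0] C lev that nonst(1) unfolding u by auto
      qed
      then have "(s + i + 1, 0) \<in> C" using bspec[OF core C] by metis
      then show "(s + (i + 1), 0) \<in> C" by (simp add: add.assoc)
    qed
  qed (use s1 in simp)
  have "(\<lambda>i. (s + i, 0)) ` {0..N} \<subseteq> C"
  proof
    fix u assume "u \<in> (\<lambda>i. (s + i, 0::int)) ` {0..N}"
    then obtain i where "u = (s + i, 0)" "0 \<le> i" "i \<le> N" by auto
    then show "u \<in> C" using inC[of i] v(1) sy s(1) by (cases "i = 0") auto
  qed
  then have "card ((\<lambda>i. (s + i, 0::int)) ` {0..N}) \<le> card C" using assms(1) by (rule card_mono[rotated])
  moreover have "card ((\<lambda>i. (s + i, 0::int)) ` {0..N}) = nat (N + 1)"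
    by (subst card_image) (auto simp: inj_on_def)
  ultimately show ?thesis using N(2) by linarith
qed

section \<open>Plane drawing\<close>

definition pos :: "int \<times> int \<Rightarrow> complex" where
  "pos v = Complex (of_int (fst v)) (of_int (snd v))"

text \<open>
  A closing edge is drawn as a trapezoid over the upper comb of its block; only this
  superset of the trapezoid matters for crossings.
\<close>
definition tent :: "int \<Rightarrow> complex set" where
  "tent s = {z. 0 \<le> Im z \<and> s - 1 \<le> Re z \<and> Re z \<le> s + N + 1 \<and>
     (Im z = 0 \<longrightarrow> Re z = s \<or> Re z = s + N) \<and>
     (0 < Im z \<and> Im z \<le> h \<longrightarrow> Re z < s \<or> s + N < Re z)}"

text \<open>A relation instead of a function on unordered pairs, so that case analysis recovers the
  type of an edge. Grid edges get their exact segments, closing edges the larger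
  \<open>tent\<close>.\<close>

inductive region :: "(int \<times> int) set \<Rightarrow> complex \<Rightarrow> bool" where
  right: "{(x, y), (x + 1, y)} \<subseteq> S \<Longrightarrow> Im z = y \<Longrightarrow> x \<le> Re z \<Longrightarrow> Re z \<le> real_of_int x + 1 \<Longrightarrow> region {(x, y), (x + 1, y)} z"
| up: "{(x, y), (x, y + 1)} \<subseteq> S \<Longrightarrow> Re z = x \<Longrightarrow> y \<le> Im z \<Longrightarrow> Im z \<le> real_of_int y + 1 \<Longrightarrow> region {(x, y), (x, y + 1)} z"
| closing: "s \<in> starts \<Longrightarrow> z \<in> tent s \<Longrightarrow> region {(s, 0), (s + N, 0)} z"

lemma pos_eq_iff: "z = pos (x, y) \<longleftrightarrow> Re z = x \<and> Im z = y"
  by (auto simp: pos_def complex_eq_iff)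

text \<open>Positive heights occur only in blocks. Blocks are six apart, whereas a tent overhangs
  its block by one only.\<close>

lemma S_upper:
  assumes "(x, y) \<in> S" "0 < y" "s \<in> starts"
  shows "y \<le> h \<and> (s \<le> x \<and> x \<le> s + N \<or> x \<le> s - 6 \<or> s + N + 6 \<le> x)"
proof -
  have "in_block x" "y \<le> h" using assms(1,2) h unfolding S_iff by (elim disjE conjE; simp)+
  then show ?thesis using assms(3) N(2) unfolding in_block_iff starts_def insert_iff empty_iff by (elim disjE conjE) simp_all
qed

text \<open>At positive heights up to \<open>h\<close> the tent is strictly beside the comb but
  within distance one, where \<open>S\<close> has no edges; on the axis it contains only the two
  ends of the block.\<close>

lemma right_tent:
  assumes "(x, y) \<in> S" "(x + 1, y) \<in> S" "s \<in> starts" "z \<in> tent s"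
    "Im z = y" "x \<le> Re z" "Re z \<le> real_of_int x + 1"
  shows "y = 0 \<and> (z = pos (s, 0) \<and> (s = x \<or> s = x + 1) \<or> z = pos (s + N, 0) \<and> (s + N = x \<or> s + N = x + 1))"
proof -
  have "y = 0"
  proof (rule ccontr)
    assume "y \<noteq> 0"
    then have y: "0 < y" using assms(4,5) by (auto simp: tent_def)
    from S_upper[OF assms(1) y assms(3)] S_upper[OF assms(2) y assms(3)]
    have "y \<le> h" "(s \<le> x \<and> x + 1 \<le> s + N) \<or> x + 1 \<le> s - 5 \<or> s + N + 6 \<le> x" by linarith+
    then have "real_of_int y \<le> h" by simp
    then have "Re z < s \<or> s + N < Re z" "s - 1 \<le> Re z" "Re z \<le> s + N + 1"
      using assms(4,5) y unfolding tent_def by simp_all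
    with \<open>s \<le> x \<and> x + 1 \<le> s + N \<or> x + 1 \<le> s - 5 \<or> s + N + 6 \<le> x\<close> assms(6,7)
    show False by (elim disjE conjE; linarith)
  qed
  moreover from this have "Re z = s \<or> Re z = s + N" using assms(4,5) by (auto simp: tent_def)
  moreover have "s = x \<or> s = x + 1" if "Re z = s" using assms(6,7) that by linarith
  moreover have "s + N = x \<or> s + N = x + 1" if "Re z = s + N" using assms(6,7) that by linarith
  ultimately show ?thesis using assms(5) unfolding pos_eq_iff by fastforce
qed

text \<open>Contact is only at a foot of the tent, with a segment that starts or ends on the
  axis.\<close>

lemma up_tent:
  assumes "(x, y) \<in> S" "(x, y + 1) \<in> S" "s \<in> starts" "z \<in> tent s"
    "Re z = x" "y \<le> Im z" "Im z \<le> real_of_int y + 1"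
  shows "Im z = 0 \<and> (x = s \<or> x = s + N) \<and> (y = 0 \<or> y + 1 = 0)"
proof -
  have z0: "Im z = 0"
  proof (rule ccontr)
    assume "Im z \<noteq> 0"
    then have pz: "0 < Im z" using assms(4) by (auto simp: tent_def)
    then have y: "0 < y + 1" using assms(7) by linarith
    from S_upper[OF assms(2) y assms(3)]
    have "y + 1 \<le> h" "(s \<le> x \<and> x \<le> s + N) \<or> x \<le> s - 6 \<or> s + N + 6 \<le> x" by linarith+
    then have "real_of_int (y + 1) \<le> h" by (simp only: of_int_le_iff)
    then have "Im z \<le> h" using assms(7) by simp
    then have "Re z < s \<or> s + N < Re z" "s - 1 \<le> Re z" "Re z \<le> s + N + 1"
      using assms(4) pz unfolding tent_def by simp_all
    with \<open>s \<le> x \<and> x \<le> s + N \<or> x \<le> s - 6 \<or> s + N + 6 \<le> x\<close> assms(5)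
    show False by (elim disjE conjE; linarith)
  qed
  moreover have "x = s \<or> x = s + N" using assms(4,5) z0 unfolding tent_def mem_Collect_eq
    by linarith
  ultimately show ?thesis using assms(6,7) by linarith
qed

lemma tents_disjoint:
  assumes "s \<in> starts" "s' \<in> starts" "z \<in> tent s" "z \<in> tent s'" shows "s = s'"
proof (rule ccontr)
  assume "s \<noteq> s'"
  then have "s + N + 6 \<le> s' \<or> s' + N + 6 \<le> s" using assms(1,2) N(2) unfolding starts_def by auto
  then show False using assms(3,4) unfolding tent_def mem_Collect_eq by linarith
qed

lemma region_cross:
  assumes "region e z" "region e' z" "e \<noteq> e'"
  shows "z \<in> pos ` (e \<inter> e')"
proof -
  have right_right: ?thesis if "e = {(x, y), (x + 1, y)}" "Im z = y" "x \<le> Re z" "Re z \<le> real_of_int x + 1"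
    "e' = {(x', y'), (x' + 1, y')}" "Im z = y'" "x' \<le> Re z" "Re z \<le> real_of_int x' + 1" for x y x' y' :: int
  proof -
    have "y = y'" using that by linarith
    have "x \<noteq> x'" using that assms(3) \<open>y = y'\<close> by auto
    then have "x' = x + 1 \<and> Re z = x + 1 \<or> x = x' + 1 \<and> Re z = x"
      using that(3,4,7,8) by linarith
    then have "z = pos (x + 1, y) \<and> x' = x + 1 \<or> z = pos (x, y) \<and> x = x' + 1"
      using that(2) by (auto simp: pos_eq_iff)
    then show ?thesis using that(1,5) \<open>y = y'\<close> by auto
  qed
  have up_up: ?thesis if "e = {(x, y), (x, y + 1)}" "Re z = x" "y \<le> Im z" "Im z \<le> real_of_int y + 1"
    "e' = {(x', y'), (x', y' + 1)}" "Re z = x'" "y' \<le> Im z" "Im z \<le> real_of_int y' + 1" for x y x' y' :: int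
  proof -
    have "x = x'" using that by linarith
    have "y \<noteq> y'" using that assms(3) \<open>x = x'\<close> by auto
    then have "y' = y + 1 \<and> Im z = y + 1 \<or> y = y' + 1 \<and> Im z = y"
      using that(3,4,7,8) by linarith
    then have "z = pos (x, y + 1) \<and> y' = y + 1 \<or> z = pos (x, y) \<and> y = y' + 1"
      using that(2) by (auto simp: pos_eq_iff)
    then show ?thesis using that(1,5) \<open>x = x'\<close> by auto
  qed
  \<comment> \<open>Stated for arbitrary \<open>f\<close> and \<open>f'\<close> to serve both orders
    of \<open>e\<close> and \<open>e'\<close>.\<close>
  have right_up: "z \<in> pos ` (f \<inter> f')" if "f = {(x, y), (x + 1, y)}" "Im z = y" "x \<le> Re z" "Re z \<le> real_of_int x + 1"
    "f' = {(x', y'), (x', y' + 1)}" "Re z = x'" "y' \<le> Im z" "Im z \<le> real_of_int y' + 1" for f f' and x y x' y' :: int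
  proof -
    have "x' = x \<or> x' = x + 1" "y = y' \<or> y = y' + 1" using that by linarith+
    moreover have "z = pos (x', y)" using that by (simp add: pos_eq_iff)
    ultimately show ?thesis using that(1,5) by auto
  qed
  have right_tent': "z \<in> pos ` (f \<inter> f')" if "{(x, y), (x + 1, y)} \<subseteq> S" "f = {(x, y), (x + 1, y)}"
    "Im z = y" "x \<le> Re z" "Re z \<le> real_of_int x + 1" "f' = {(s, 0), (s + N, 0)}" "s \<in> starts" "z \<in> tent s" for f f' x y s
    using right_tent[of x y s z] that by auto
  have up_tent': "z \<in> pos ` (f \<inter> f')" if "{(x, y), (x, y + 1)} \<subseteq> S" "f = {(x, y), (x, y + 1)}"
    "Re z = x" "y \<le> Im z" "Im z \<le> real_of_int y + 1" "f' = {(s, 0), (s + N, 0)}" "s \<in> starts" "z \<in> tent s" for f f' x y s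
  proof -
    have "z = pos (x, 0)" "x = s \<or> x = s + N" "y = 0 \<or> y + 1 = 0"
      using up_tent[of x y s z] that by (auto simp: pos_eq_iff)
    then show ?thesis using that(2,6) by auto
  qed
  from assms(1) show ?thesis
  proof cases
    case r: (right x y)
    from assms(2) show ?thesis
    proof cases
      case (right x' y') then show ?thesis using right_right[OF r(1,3-5) right(1,3-5)] by blast
    next
      case (up x' y') then show ?thesis using right_up[OF r(1,3-5) up(1,3-5)] by blast
    next
      case (closing s) then show ?thesis using right_tent'[OF r(2,1,3-5) closing] by blast
    qed
  next
    case u: (up x y)
    from assms(2) show ?thesis
    proof cases
      case (right x' y')
      then show ?thesis using right_up[OF right(1,3-5) u(1,3-5)] by (simp only: Int_commute)
    next
      case (up x' y') then show ?thesis using up_up[OF u(1,3-5) up(1,3-5)] by blast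
    next
      case (closing s) then show ?thesis using up_tent'[OF u(2,1,3-5) closing] by blast
    qed
  next
    case c: (closing s)
    from assms(2) show ?thesis
    proof cases
      case (right x' y')
      then show ?thesis using right_tent'[OF right(2,1,3-5) c] by (simp only: Int_commute)
    next
      case (up x' y')
      then show ?thesis using up_tent'[OF up(2,1,3-5) c] by (simp only: Int_commute)
    next
      case (closing s')
      then have "s = s'" using tents_disjoint c(2,3) by blast
      then show ?thesis using c(1) closing(1) assms(3) by simp
    qed
  qed
qed

lemma region_vertex:
  assumes "region e (pos v)" "v \<in> S" shows "v \<in> e"
proof -
  obtain x y where v: "v = (x, y)" by (cases v)
  have z: "Re (pos v) = x" "Im (pos v) = y" by (simp_all add: pos_def v)
  from assms(1) show ?thesis
  proof cases
    case (right x' y')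
    then have "y = y'" "x = x' \<or> x = x' + 1" using z by linarith+
    then show ?thesis using right v by auto
  next
    case (up x' y')
    then have "x = x'" "y = y' \<or> y = y' + 1" using z by linarith+
    then show ?thesis using up v by auto
  next
    case (closing s)
    have "y = 0"
    proof (rule ccontr)
      assume "y \<noteq> 0"
      then have y: "0 < y" using closing(3) z by (auto simp: tent_def)
      show False
        using S_upper[of x y s] assms(2) y closing(2,3) z unfolding v tent_def mem_Collect_eq by auto
    qed
    then have "x = s \<or> x = s + N" using closing(3) z by (auto simp: tent_def)
    then show ?thesis using closing v \<open>y = 0\<close> by auto
  qed
qed

text \<open>The legs of the trapezoid lean outwards by one, and its roof runs at height
  \<open>h + 1\<close>, one above the comb.\<close>

lemma closing_arc:
  assumes "s \<in> starts"
  shows "\<exists>\<gamma>. arc \<gamma> \<and> pathstart \<gamma> = pos (s, 0) \<and> pathfinish \<gamma> = pos (s + N, 0) \<and> path_image \<gamma> \<subseteq> tent s"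
proof -
  define a b c d where "a = pos (s, 0)" and "b = pos (s - 1, h + 1)"
    and "c = pos (s + N + 1, h + 1)" and "d = pos (s + N, 0)"
  note defs = a_def b_def c_def d_def pos_def
  have ab: "\<exists>t::real. 0 \<le> t \<and> t \<le> 1 \<and> Re z = s - t \<and> Im z = t * (h + 1)" if z: "z \<in> closed_segment a b" for z
  proof -
    obtain t where t: "0 \<le> t" "t \<le> 1" "z = (1 - t) *\<^sub>R a + t *\<^sub>R b" using z unfolding in_segment by blast
    show ?thesis using t(1,2) by (intro exI[of _ t]) (simp add: t(3) defs algebra_simps)
  qed
  have cd: "\<exists>t::real. 0 \<le> t \<and> t \<le> 1 \<and> Re z = s + N + t \<and> Im z = t * (h + 1)" if z: "z \<in> closed_segment d c" for z
  proof -
    obtain t where t: "0 \<le> t" "t \<le> 1" "z = (1 - t) *\<^sub>R d + t *\<^sub>R c" using z unfolding in_segment by blast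
    show ?thesis using t(1,2) by (intro exI[of _ t]) (simp add: t(3) defs algebra_simps)
  qed
  have bc: "Im z = h + 1 \<and> s - 1 \<le> Re z \<and> Re z \<le> s + N + 1" if z: "z \<in> closed_segment b c" for z
  proof -
    obtain t where t: "0 \<le> t" "t \<le> 1" "z = (1 - t) *\<^sub>R b + t *\<^sub>R c" using z unfolding in_segment by blast
    have "0 \<le> t * (N + 2)" "t * real_of_int (N + 2) \<le> 1 * real_of_int (N + 2)" using t(1,2) N(2)
      by (intro mult_nonneg_nonneg mult_right_mono; simp)+
    then show ?thesis by (simp add: t(3) defs algebra_simps)
  qed
  have h': "real_of_int h \<ge> 2" "real_of_int N \<ge> 2" using h N(2) by simp_all
  have full: "t = 1" if "t * (real_of_int h + 1) = real_of_int h + 1" for t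
    using that h' by simp
  have "arc (linepath a b +++ linepath b c +++ linepath c d)"
  proof (rule arc_join3_linepath)
    show "a \<noteq> b" "b \<noteq> c" "c \<noteq> d" using h' by (auto simp: defs)
    show "closed_segment a b \<inter> closed_segment b c \<subseteq> {b}"
    proof
      fix z assume "z \<in> closed_segment a b \<inter> closed_segment b c"
      then obtain t :: real where "Re z = s - t" "Im z = t * (h + 1)" "Im z = h + 1" using ab bc by blast
      then show "z \<in> {b}" using full[of t] by (simp add: b_def pos_eq_iff)
    qed
    show "closed_segment b c \<inter> closed_segment c d \<subseteq> {c}"
    proof
      fix z assume "z \<in> closed_segment b c \<inter> closed_segment c d"
      then obtain t :: real where "Re z = s + N + t" "Im z = t * (h + 1)" "Im z = h + 1"
        using cd bc by (metis IntD1 IntD2 closed_segment_commute)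
      then show "z \<in> {c}" using full[of t] by (simp add: c_def pos_eq_iff)
    qed
    show "closed_segment a b \<inter> closed_segment c d = {}"
    proof (rule equals0I)
      fix z assume "z \<in> closed_segment a b \<inter> closed_segment c d"
      then obtain t u :: real where "Re z = s - t" "0 \<le> t" "Re z = s + N + u" "0 \<le> u"
        using ab cd by (metis IntD1 IntD2 closed_segment_commute)
      then show False using h' by linarith
    qed
  qed
  moreover have "path_image (linepath a b +++ linepath b c +++ linepath c d) \<subseteq> tent s"
  proof
    fix z assume "z \<in> path_image (linepath a b +++ linepath b c +++ linepath c d)"
    then consider "z \<in> closed_segment a b" | "z \<in> closed_segment b c" | "z \<in> closed_segment d c"
      by (auto simp: path_image_join closed_segment_commute)
    then show "z \<in> tent s"
    proof cases
      case 1
      then obtain t :: real where t: "0 \<le> t" "t \<le> 1" "Re z = s - t" "Im z = t * (h + 1)" using ab by blast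
      have Im: "t = 0 \<longleftrightarrow> Im z = 0" "0 \<le> Im z" using h' t by simp_all
      have "0 < t" if "0 < Im z" using that t(1) Im(1) by linarith
      then show ?thesis using t(1-3) Im h' unfolding tent_def by auto
    next
      case 2
      then show ?thesis using bc[OF 2] h' unfolding tent_def by auto
    next
      case 3
      then obtain t :: real where t: "0 \<le> t" "t \<le> 1" "Re z = s + N + t" "Im z = t * (h + 1)" using cd by blast
      have Im: "t = 0 \<longleftrightarrow> Im z = 0" "0 \<le> Im z" using h' t by simp_all
      have "0 < t" if "0 < Im z" using that t(1) Im(1) by linarith
      then show ?thesis using t(1-3) Im h' unfolding tent_def by auto
    qed
  qed
  ultimately show ?thesis
    by (intro exI[of _ "linepath a b +++ linepath b c +++ linepath c d"]) (simp add: a_def d_def)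
qed

lemma region_arc:
  assumes "e \<in> E"
  shows "\<exists>\<gamma>. arc \<gamma> \<and> {pathstart \<gamma>, pathfinish \<gamma>} = pos ` e \<and> path_image \<gamma> \<subseteq> Collect (region e)"
proof -
  obtain u v where "e = {u, v}" "u \<in> S" "v \<in> S" "step u v"
    using assms unfolding E_def by blast
  then obtain x y where e: "e = {(x, y), v}" "(x, y) \<in> S" "v \<in> S" "step (x, y) v"
    by (cases u) blast
  from e(4) consider "v = (x + 1, y)" | "v = (x, y + 1)" | "y = 0" "x \<in> starts" "v = (x + N, 0)"
    unfolding step_def by auto
  then show ?thesis
  proof cases
    case 1
    have "region e z" if z: "z \<in> closed_segment (pos (x, y)) (pos (x + 1, y))" for z
    proof -
      obtain t where "0 \<le> t" "t \<le> 1" and t: "z = (1 - t) *\<^sub>R pos (x, y) + t *\<^sub>R pos (x + 1, y)"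
        using z unfolding in_segment by blast
      moreover have "Re z = x + t" "Im z = y" by (simp_all add: t pos_def algebra_simps)
      ultimately show ?thesis using e 1 region.right[of x y z] by simp
    qed
    moreover have "pos (x, y) \<noteq> pos (x + 1, y)" by (simp add: pos_def)
    ultimately show ?thesis using e 1
      by (intro exI[of _ "linepath (pos (x, y)) (pos (x + 1, y))"]) (auto simp: arc_linepath)
  next
    case 2
    have "region e z" if z: "z \<in> closed_segment (pos (x, y)) (pos (x, y + 1))" for z
    proof -
      obtain t where "0 \<le> t" "t \<le> 1" and t: "z = (1 - t) *\<^sub>R pos (x, y) + t *\<^sub>R pos (x, y + 1)"
        using z unfolding in_segment by blast
      moreover have "Re z = x" "Im z = y + t" by (simp_all add: t pos_def algebra_simps)
      ultimately show ?thesis using e 2 region.up[of x y z] by simp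
    qed
    moreover have "pos (x, y) \<noteq> pos (x, y + 1)" by (simp add: pos_def)
    ultimately show ?thesis using e 2
      by (intro exI[of _ "linepath (pos (x, y)) (pos (x, y + 1))"]) (auto simp: arc_linepath)
  next
    case 3
    obtain \<gamma> where \<gamma>: "arc \<gamma>" "pathstart \<gamma> = pos (x, 0)" "pathfinish \<gamma> = pos (x + N, 0)" "path_image \<gamma> \<subseteq> tent x"
      using closing_arc[OF 3(2)] by blast
    have "path_image \<gamma> \<subseteq> Collect (region e)"
      using \<gamma>(4) region.closing[OF 3(2)] e 3 by auto
    then show ?thesis using \<gamma> e 3 by (intro exI[of _ \<gamma>]) simp
  qed
qed

lemma planar: "planar_graph S E"
proof (rule planar_graph_by_regions[where p = pos and K = "\<lambda>e. Collect (region e)"])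
  show "inj_on pos S" by (auto simp: inj_on_def pos_def)
  show "e \<subseteq> S \<and> (\<exists>\<gamma>. arc \<gamma> \<and> {pathstart \<gamma>, pathfinish \<gamma>} = pos ` e \<and> path_image \<gamma> \<subseteq> Collect (region e))"
    if "e \<in> E" for e
    using region_arc[OF that] simple_E that by blast
qed (use region_vertex region_cross in auto)

section \<open>A 3-fold list assignment without packing\<close>

text \<open>The order of the entries matters: it is the reference for \<open>oriented\<close>. The
  bound \<open>x < 2 * N + 6\<close> leaves the odd tail point \<open>2 * N + 7\<close> with the
  list \<open>C\<close>.\<close>

definition triple :: "int \<times> int \<Rightarrow> nat \<times> nat \<times> nat" where
  "triple v = (case v of (x, y) \<Rightarrow>
     if y < - h \<or> x < 0 \<or> 3 * N + 12 < x \<or> (0 < y \<or> y = 0 \<and> even x) \<and> (x \<le> N \<or> 2 * N + 12 \<le> x)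
     then (1, 2, 3)
     else if (y < 0 \<or> y = 0 \<and> odd x) \<and> x < 2 * N + 6 then (1, 2, 4)
     else (1, 3, 4))"

lemma triple_eq:
  "triple (x, y) = (if y < - h \<or> x < 0 \<or> 3 * N + 12 < x \<or> (0 < y \<or> y = 0 \<and> even x) \<and> (x \<le> N \<or> 2 * N + 12 \<le> x)
     then (1, 2, 3)
     else if (y < 0 \<or> y = 0 \<and> odd x) \<and> x < 2 * N + 6 then (1, 2, 4)
     else (1, 3, 4))"
  by (simp only: triple_def prod.case)

section \<open>Transmission of one bit along the linking paths\<close>

lemma row_constant:
  assumes P: "\<And>u v. {u, v} \<in> E \<Longrightarrow> triple u = triple v \<Longrightarrow> P u = P v"
    and "a \<le> x" and "\<And>z. a \<le> z \<Longrightarrow> z \<le> x \<Longrightarrow> (z, y) \<in> S \<and> triple (z, y) = t"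
  shows "P (x, y) = P (a, y)"
  using assms(2,3)
proof (induction x rule: int_ge_induct)
  case (step x)
  have "step (x, y) (x + 1, y)" by (simp add: step_def)
  then have "P (x, y) = P (x + 1, y)"
    using step.prems[of x] step.prems[of "x + 1"] step.hyps by (intro P) (simp_all add: edge_iff)
  moreover have "P (x, y) = P (a, y)" using step.prems by (intro step.IH) simp
  ultimately show ?case by simp
qed simp

lemma column_constant:
  assumes P: "\<And>u v. {u, v} \<in> E \<Longrightarrow> triple u = triple v \<Longrightarrow> P u = P v"
    and "a \<le> y" and "\<And>z. a \<le> z \<Longrightarrow> z \<le> y \<Longrightarrow> (x, z) \<in> S \<and> triple (x, z) = t"
  shows "P (x, y) = P (x, a)"
  using assms(2,3)
proof (induction y rule: int_ge_induct)
  case (step y)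
  have "step (x, y) (x, y + 1)" by (simp add: step_def)
  then have "P (x, y) = P (x, y + 1)"
    using step.prems[of y] step.prems[of "y + 1"] step.hyps by (intro P) (simp_all add: edge_iff)
  moreover have "P (x, y) = P (x, a)" using step.prems by (intro step.IH) simp
  ultimately show ?case by simp
qed simp

text \<open>\<open>P\<close> abstracts the orientation bit; only its invariance along edges with
  equal triples is assumed.\<close>

context
  fixes P :: "int \<times> int \<Rightarrow> bool"
  assumes P: "\<And>u v. {u, v} \<in> E \<Longrightarrow> triple u = triple v \<Longrightarrow> P u = P v"
begin

text \<open>The path runs up one tooth, along the row at height \<open>h\<close>, and down the tooth
  at \<open>s\<close>.\<close>

lemma upper_comb:
  assumes "s \<in> starts" "even x" "s \<le> x" "x \<le> s + N"
  shows "P (x, 0) = P (s, 0)"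
proof -
  define t :: "nat \<times> nat \<times> nat" where "t = (if s = N + 6 then (1, 3, 4) else (1, 2, 3))"
  have s: "s = 0 \<or> s = N + 6 \<or> s = 2 * N + 12" using assms(1) by (simp add: starts_def)
  then have "even s" using N(1) by auto
  have col: "(z, y) \<in> S \<and> triple (z, y) = t" if "even z \<or> y = h" "s \<le> z" "z \<le> s + N" "0 \<le> y" "y \<le> h" for z y
    using s that N(2) h unfolding S_iff in_block_iff triple_eq t_def by (elim disjE) auto
  have "P (x, h) = P (x, 0)" using col assms(2-) h by (intro column_constant[OF P]) auto
  moreover have "P (s, h) = P (s, 0)" using col \<open>even s\<close> N(2) h by (intro column_constant[OF P]) auto
  moreover have "P (x, h) = P (s, h)" using col assms(2-) h by (intro row_constant[OF P]) auto
  ultimately show ?thesis by simp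
qed

lemma lower_tooth:
  assumes "s \<in> starts" "odd x" "s \<le> x" "x \<le> s + N"
  shows "P (x, 0) = P (x, - h)"
proof -
  define t :: "nat \<times> nat \<times> nat" where "t = (if s = 2 * N + 12 then (1, 3, 4) else (1, 2, 4))"
  have s: "s = 0 \<or> s = N + 6 \<or> s = 2 * N + 12" using assms(1) by (simp add: starts_def)
  then have "even s" "even (s + N)" using N(1) by auto
  then have x: "s + 1 \<le> x" "x \<le> s + N - 1" using assms(2-) by (cases "x = s"; cases "x = s + N"; auto)+
  have "(x, y) \<in> S \<and> triple (x, y) = t" if "- h \<le> y" "y \<le> 0" for y
    using s that x assms(2) N(2) h unfolding S_iff in_block_iff triple_eq t_def by (elim disjE) auto
  then show ?thesis using h by (intro column_constant[OF P]) auto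
qed

text \<open>The odd teeth of the first two blocks end on one stretch of the row at height
  \<open>- h\<close>, whose leftmost point serves as reference.\<close>

lemma spine_B:
  assumes "odd x" "0 \<le> x \<and> x \<le> N \<or> N + 6 \<le> x \<and> x \<le> 2 * N + 6"
  shows "P (x, 0) = P (1, - h)"
proof -
  have "x \<noteq> 0" "x \<noteq> 2 * N + 6" using assms(1) by auto
  then have x: "1 \<le> x" "x \<le> 2 * N + 5" using assms(2) N(2) by auto
  have "P (x, 0) = P (x, - h)"
    using assms lower_tooth[of 0 x] lower_tooth[of "N + 6" x] by (auto simp: starts_def)
  also have "(z, - h) \<in> S \<and> triple (z, - h) = (1, 2, 4)" if "1 \<le> z" "z \<le> x" for z
    using that x N(2) h unfolding S_iff in_block_iff triple_eq by auto
  then have "P (x, - h) = P (1, - h)" using x by (intro row_constant[OF P]) auto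
  finally show ?thesis .
qed

text \<open>The comb of the second block leads to its right end, then over a short tail and down the
  column at \<open>2 * N + 8\<close> to the row that joins the odd teeth of the third block.\<close>

lemma spine_C:
  assumes "even x \<and> N + 6 \<le> x \<and> x \<le> 2 * N + 6 \<or> odd x \<and> 2 * N + 12 \<le> x \<and> x \<le> 3 * N + 12"
  shows "P (x, 0) = P (2 * N + 8, - h)"
proof -
  have tail: "P (2 * N + 6, 0) = P (2 * N + 8, - h)"
  proof -
    \<comment> \<open>On the axis \<open>triple\<close> depends on parity, so the three tail points
      are checked one by one.\<close>
    have "z = 2 * N + 6 \<or> z = 2 * N + 7 \<or> z = 2 * N + 8" if "2 * N + 6 \<le> z" "z \<le> 2 * N + 8" for z
      using that by linarith
    moreover have "(2 * N + 6, 0) \<in> S \<and> triple (2 * N + 6, 0) = (1, 3, 4)"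
      "(2 * N + 7, 0) \<in> S \<and> triple (2 * N + 7, 0) = (1, 3, 4)"
      "(2 * N + 8, 0) \<in> S \<and> triple (2 * N + 8, 0) = (1, 3, 4)"
      using N h unfolding S_iff in_block_iff triple_eq by simp_all
    ultimately have "(z, 0) \<in> S \<and> triple (z, 0) = (1, 3, 4)" if "2 * N + 6 \<le> z" "z \<le> 2 * N + 8" for z
      using that by blast
    then have "P (2 * N + 8, 0) = P (2 * N + 6, 0)" by (intro row_constant[OF P]) auto
    moreover have "(2 * N + 8, y) \<in> S \<and> triple (2 * N + 8, y) = (1, 3, 4)" if "- h \<le> y" "y \<le> 0" for y
      using that N(2) h unfolding S_iff in_block_iff triple_eq by auto
    then have "P (2 * N + 8, 0) = P (2 * N + 8, - h)" using h by (intro column_constant[OF P]) auto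
    ultimately show ?thesis by simp
  qed
  show ?thesis
  proof (cases "x \<le> 2 * N + 6")
    case True
    then show ?thesis
      using assms upper_comb[of "N + 6" x] upper_comb[of "N + 6" "2 * N + 6"] tail N(2) by (auto simp: starts_def)
  next
    case False
    then have x: "odd x" "2 * N + 12 \<le> x" "x \<le> 3 * N + 12" using assms by auto
    then have "x \<noteq> 3 * N + 12" using N(1) by auto
    then have x': "x \<le> 3 * N + 11" using x by linarith
    have "P (x, 0) = P (x, - h)" using x lower_tooth[of "2 * N + 12" x] by (auto simp: starts_def)
    also have "(z, - h) \<in> S \<and> triple (z, - h) = (1, 3, 4)" if "2 * N + 8 \<le> z" "z \<le> x" for z
      using that x' N(2) h unfolding S_iff in_block_iff triple_eq by auto
    then have "P (x, - h) = P (2 * N + 8, - h)" using x by (intro row_constant[OF P]) auto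
    finally show ?thesis .
  qed
qed

text \<open>The first and third combs are linked around the outside: left tail, left column, bottom
  row, right column, right tail.\<close>

lemma spine_A:
  assumes "even x" "0 \<le> x \<and> x \<le> N \<or> 2 * N + 12 \<le> x \<and> x \<le> 3 * N + 12"
  shows "P (x, 0) = P (-2, - 2 * h)"
proof -
  have "z = -2 \<or> z = -1 \<or> z = 0" if "-2 \<le> z" "z \<le> 0" for z :: int
    using that by linarith
  moreover have "(-2, 0) \<in> S \<and> triple (-2, 0) = (1, 2, 3)"
    "(-1, 0) \<in> S \<and> triple (-1, 0) = (1, 2, 3)"
    "(0, 0) \<in> S \<and> triple (0, 0) = (1, 2, 3)"
    using N h unfolding S_iff in_block_iff triple_eq by simp_all
  ultimately have "(z, 0) \<in> S \<and> triple (z, 0) = (1, 2, 3)" if "-2 \<le> z" "z \<le> 0" for z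
    using that by blast
  then have "P (0, 0) = P (-2, 0)" by (intro row_constant[OF P]) auto
  moreover have "(x, y) \<in> S \<and> triple (x, y) = (1, 2, 3)" if "- 2 * h \<le> y" "y \<le> 0" "x \<in> {-2, 3 * N + 14}" for x y
    using that N(2) h unfolding S_iff in_block_iff triple_eq by auto
  then have "P (-2, 0) = P (-2, - 2 * h)" "P (3 * N + 14, 0) = P (3 * N + 14, - 2 * h)"
    using h by (intro column_constant[OF P]; auto)+
  moreover have "(z, - 2 * h) \<in> S \<and> triple (z, - 2 * h) = (1, 2, 3)" if "-2 \<le> z" "z \<le> 3 * N + 14" for z
    using that N(2) h unfolding S_iff in_block_iff triple_eq by auto
  then have "P (3 * N + 14, - 2 * h) = P (-2, - 2 * h)" using N(2) by (intro row_constant[OF P]) auto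
  moreover have "P (3 * N + 14, 0) = P (3 * N + 12, 0)"
  proof -
    have "z = 3 * N + 12 \<or> z = 3 * N + 13 \<or> z = 3 * N + 14" if "3 * N + 12 \<le> z" "z \<le> 3 * N + 14" for z
      using that by linarith
    moreover have "(3 * N + 12, 0) \<in> S \<and> triple (3 * N + 12, 0) = (1, 2, 3)"
      "(3 * N + 13, 0) \<in> S \<and> triple (3 * N + 13, 0) = (1, 2, 3)"
      "(3 * N + 14, 0) \<in> S \<and> triple (3 * N + 14, 0) = (1, 2, 3)"
      using N h unfolding S_iff in_block_iff triple_eq by simp_all
    ultimately have "(z, 0) \<in> S \<and> triple (z, 0) = (1, 2, 3)" if "3 * N + 12 \<le> z" "z \<le> 3 * N + 14" for z
      using that by blast
    then show ?thesis by (intro row_constant[OF P]) auto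
  qed
  moreover have "P (3 * N + 12, 0) = P (2 * N + 12, 0)"
    using N by (intro upper_comb) (auto simp: starts_def)
  moreover have "P (x, 0) = P (0, 0) \<or> P (x, 0) = P (2 * N + 12, 0)"
    using assms upper_comb[of 0 x] upper_comb[of "2 * N + 12" x] by (auto simp: starts_def)
  ultimately show ?thesis by argo
qed

end

section \<open>The contradiction on the three odd cycles\<close>

lemma spine_edge:
  assumes "s \<in> starts" "i < nat N"
  shows "{(s + int i, 0), (s + int (Suc i), 0)} \<in> E"
proof -
  have "in_block (s + int i)" "in_block (s + int (Suc i))"
    using assms unfolding in_block_def by (intro bexI[of _ s]; linarith)+
  then show ?thesis by (simp add: edge_iff S_iff step_def algebra_simps)
qed

lemma closing_edge:
  assumes "s \<in> starts"
  shows "{(s, 0), (s + N, 0)} \<in> E"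
proof -
  have "in_block s" "in_block (s + N)"
    using assms N(2) unfolding in_block_def by (intro bexI[of _ s]; linarith)+
  then show ?thesis using assms by (simp add: edge_iff S_iff step_def)
qed

definition lists :: "int \<times> int \<Rightarrow> nat set" where
  "lists v = (case triple v of (a, b, x) \<Rightarrow> {a, b, x})"

lemma triple_cases: "triple v \<in> {(1, 2, 3), (1, 2, 4), (1, 3, 4)}"
  by (cases v) (simp add: triple_eq)

lemma lists_3_fold: "k_fold S 3 lists"
proof -
  have "finite (lists v) \<and> card (lists v) = 3" for v
    using triple_cases[of v] unfolding lists_def insert_iff empty_iff by (elim disjE) simp_all
  then show ?thesis by (simp add: k_fold_def)
qed

text \<open>Since \<open>s\<close> is even, the parity of the abscissa is the parity of the position
  on the cycle.\<close>

lemma spine_cycle_orientation: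
  assumes c: "L_packing S E 3 lists c" and "distinct [a, b, x, y]" and s: "s \<in> starts"
    and ev: "\<And>z. even z \<Longrightarrow> s \<le> z \<Longrightarrow> z \<le> s + N \<Longrightarrow> oriented (a, b, x) (word c (z, 0))"
    and od: "\<And>z. odd z \<Longrightarrow> s \<le> z \<Longrightarrow> z \<le> s + N \<Longrightarrow> oriented (b, a, y) (word c (z, 0))"
  shows False
proof -
  have evens: "even s" using s N(1) by (auto simp: starts_def)
  define m where "m = nat (N div 2)"
  have m: "2 * int m = N" "2 * m = nat N" using N by (auto simp: m_def)
  show ?thesis
  proof (rule odd_cycle_orientation[OF c assms(2), of m "\<lambda>i. (s + int i, 0)"])
    show "{(s + int i, 0), (s + int (Suc i), 0)} \<in> E" if "i < 2 * m" for i
      using spine_edge[OF s] that m by simp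
    show "{(s + int 0, 0), (s + int (2 * m), 0)} \<in> E" using closing_edge[OF s] m by simp
    show "oriented (a, b, x) (word c (s + int (2 * i), 0))" if "i \<le> m" for i
      using that evens m by (intro ev) auto
    show "oriented (b, a, y) (word c (s + int (2 * i + 1), 0))" if "i < m" for i
      using that evens m by (intro od) auto
  qed
qed

lemma not_3_packable: "\<not> L_packing S E 3 lists c"
proof
  assume c: "L_packing S E 3 lists c"
  define P where "P v = oriented (triple v) (word c v)" for v
  have P: "P u = P v" if e: "{u, v} \<in> E" "triple u = triple v" for u v
  proof -
    obtain a b x where t: "triple u = (a, b, x)" by (cases "triple u")
    have "distinct [a, b, x]" using triple_cases[of u] t by auto
    moreover have "u \<in> S" "v \<in> S" using e(1) edge_iff by auto
    moreover have t': "triple v = (a, b, x)" using e(2) t by simp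
    moreover have "lists u = {a, b, x}" "lists v = {a, b, x}" by (simp_all add: lists_def t t')
    ultimately show ?thesis
      using oriented_same_list[OF c _ _ e(1), of a b x] unfolding P_def t t' by blast
  qed
  have flip: "oriented (b, a, x) (word c v)" if "v \<in> S" "triple v = (a, b, x)" "\<not> P v" for v a b x
    using L_packing_word[OF c that(1), of a b x] that(2,3) by (auto simp: P_def lists_def)
  have keep: "oriented (a, b, x) (word c v)" if "triple v = (a, b, x)" "P v" for v a b x
    using that by (simp add: P_def)
  have spine: "(z, 0) \<in> S" if "s \<in> starts" "s \<le> z" "z \<le> s + N" for s z
    using that by (auto simp: S_iff in_block_def)
  \<comment> \<open>One bit for each linked system, read off at its reference point.\<close>
  define PA PB PC where "PA = P (-2, - 2 * h)" and "PB = P (1, - h)" and "PC = P (2 * N + 8, - h)"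
  have A: "triple (z, 0) = (1, 2, 3)" "P (z, 0) = PA"
    if "even z" "0 \<le> z \<and> z \<le> N \<or> 2 * N + 12 \<le> z \<and> z \<le> 3 * N + 12" for z
    using that h spine_A[of P z] P by (auto simp: triple_eq PA_def)
  have B: "triple (z, 0) = (1, 2, 4)" "P (z, 0) = PB"
    if "odd z" "0 \<le> z \<and> z \<le> N \<or> N + 6 \<le> z \<and> z \<le> 2 * N + 6" for z
  proof -
    have "z \<noteq> 2 * N + 6" using that by auto
    then show "triple (z, 0) = (1, 2, 4)" using that h N(2) by (auto simp: triple_eq)
    show "P (z, 0) = PB" using that spine_B[of P z] P by (auto simp: PB_def)
  qed
  have C: "triple (z, 0) = (1, 3, 4)" "P (z, 0) = PC"
    if "even z \<and> N + 6 \<le> z \<and> z \<le> 2 * N + 6 \<or> odd z \<and> 2 * N + 12 \<le> z \<and> z \<le> 3 * N + 12" for z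
    using that h N(2) spine_C[of P z] P by (auto simp: triple_eq PC_def)
  have st: "0 \<in> starts" "N + 6 \<in> starts" "2 * N + 12 \<in> starts" by (simp_all add: starts_def)
  have A1: "oriented (1, 2, 3) (word c (z, 0))"
    if "PA" "even z" "0 \<le> z \<and> z \<le> N \<or> 2 * N + 12 \<le> z \<and> z \<le> 3 * N + 12" for z
    using keep A that by metis
  have A0: "oriented (2, 1, 3) (word c (z, 0))"
    if "\<not> PA" "even z" "0 \<le> z \<and> z \<le> N \<or> 2 * N + 12 \<le> z \<and> z \<le> 3 * N + 12" for z
    using flip[of "(z, 0)"] spine[of _ z] A[of z] st that by auto
  have B1: "oriented (1, 2, 4) (word c (z, 0))"
    if "PB" "odd z" "0 \<le> z \<and> z \<le> N \<or> N + 6 \<le> z \<and> z \<le> 2 * N + 6" for z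
    using keep B that by metis
  have B0: "oriented (2, 1, 4) (word c (z, 0))"
    if "\<not> PB" "odd z" "0 \<le> z \<and> z \<le> N \<or> N + 6 \<le> z \<and> z \<le> 2 * N + 6" for z
    using flip[of "(z, 0)"] spine[of _ z] B[of z] st that by auto
  have C1: "oriented (1, 3, 4) (word c (z, 0))"
    if "PC" "even z \<and> N + 6 \<le> z \<and> z \<le> 2 * N + 6 \<or> odd z \<and> 2 * N + 12 \<le> z \<and> z \<le> 3 * N + 12" for z
    using keep C that by metis
  have C0: "oriented (3, 1, 4) (word c (z, 0))"
    if "\<not> PC" "even z \<and> N + 6 \<le> z \<and> z \<le> 2 * N + 6 \<or> odd z \<and> 2 * N + 12 \<le> z \<and> z \<le> 3 * N + 12" for z
    using flip[of "(z, 0)"] spine[of _ z] C[of z] st that by auto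
  \<comment> \<open>The first block forces \<open>PA = PB\<close>.\<close>
  have "\<not> (PA \<and> \<not> PB)"
  proof
    assume *: "PA \<and> \<not> PB"
    show False
      by (rule spine_cycle_orientation[OF c, of 1 2 3 4 0]) (use * A1 B0 st in simp_all)
  qed
  moreover have "\<not> (\<not> PA \<and> PB)"
  proof
    assume *: "\<not> PA \<and> PB"
    show False
      by (rule spine_cycle_orientation[OF c, of 2 1 3 4 0]) (use * A0 B1 st in simp_all)
  qed
  \<comment> \<open>The second block forces \<open>PB = PC\<close>. The common colours are 1 and 4,
    so triples are rotated to bring these to the front.\<close>
  moreover have "\<not> (PC \<and> \<not> PB)"
  proof
    assume *: "PC \<and> \<not> PB"
    show False
      by (rule spine_cycle_orientation[OF c, of 4 1 3 2 "N + 6"])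
        (use * C1 B0 st in \<open>simp_all add: oriented_rotate[of 4 1 3] oriented_rotate[of 1 4 2] oriented_rotate[of 4 2 1] del: One_nat_def\<close>)
  qed
  moreover have "\<not> (\<not> PC \<and> PB)"
  proof
    assume *: "\<not> PC \<and> PB"
    show False
      by (rule spine_cycle_orientation[OF c, of 1 4 3 2 "N + 6"])
        (use * C0 B1 st in \<open>simp_all add: oriented_rotate[of 4 1 2] oriented_rotate[of 1 4 3] oriented_rotate[of 4 3 1] del: One_nat_def\<close>)
  qed
  \<comment> \<open>The third block forces \<open>PA\<close> and \<open>PC\<close> to differ:
    replacing 2 by 4 in \<open>(1, 2, 3)\<close> gives \<open>(1, 4, 3)\<close>, the reverse of
    \<open>(1, 3, 4)\<close>.\<close>
  moreover have "\<not> (PA \<and> PC)"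
  proof
    assume *: "PA \<and> PC"
    show False
      by (rule spine_cycle_orientation[OF c, of 3 1 2 4 "2 * N + 12"])
        (use * A1 C1 st in \<open>simp_all add: oriented_rotate[of 3 1 2] del: One_nat_def\<close>)
  qed
  moreover have "\<not> (\<not> PA \<and> \<not> PC)"
  proof
    assume *: "\<not> PA \<and> \<not> PC"
    show False
      by (rule spine_cycle_orientation[OF c, of 1 3 2 4 "2 * N + 12"])
        (use * A0 C0 st in \<open>simp_all add: oriented_rotate[of 1 3 2] oriented_rotate[of 3 2 1] del: One_nat_def\<close>)
  qed
  ultimately show False by blast
qed

lemma not_small_packable:
  assumes "1 \<le> k" "k \<le> 2"
  shows "\<not> L_packing S E k (\<lambda>_. {..<k}) c"
proof -
  define m where "m = nat (N div 2)"
  have m: "2 * int m = N" "2 * m = nat N" using N by (auto simp: m_def)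
  have s: "0 \<in> starts" by (simp add: starts_def)
  show ?thesis
  proof (rule odd_cycle_two_colours[OF _ _ _ assms, of m "\<lambda>i. (0 + int i, 0)"])
    show "{(0 + int i, 0), (0 + int (Suc i), 0)} \<in> E" if "i < 2 * m" for i
      using spine_edge[OF s] that m by simp
    show "{(0 + int 0, 0), (0 + int (2 * m), 0)} \<in> E" using closing_edge[OF s] m by simp
    show "(0 + int i, 0) \<in> S" if "i \<le> 2 * m" for i
      using that m by (auto simp: S_iff in_block_iff)
  qed
qed

lemma girth:
  assumes "int g < h" "int g \<le> N"
  shows "girth_at_least S E g"
proof (rule girth_at_least_if_cores_large)
  fix C :: "(int \<times> int) set"
  assume "finite C" "C \<noteq> {}" "\<forall>v\<in>C. \<exists>u\<in>C. \<exists>w\<in>C. u \<noteq> w \<and> {v, u} \<in> E \<and> {v, w} \<in> E"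
  then have "min (h - 1) (N + 1) \<le> int (card C)" by (rule core_large)
  then show "g \<le> card C" using assms by linarith
qed

text \<open>Each \<open>k < 4\<close> is excluded by its own list-assignment, without appeal to
  monotonicity in \<open>k\<close>.\<close>

lemma list_packing_number_eq_4: "list_packing_number S E = 4"
  unfolding list_packing_number_def
proof (rule Least_equality)
  have "\<exists>c. L_packing S E 4 L c" if "k_fold S 4 L" for L
    using finite_S that simple_E two_degenerate by (rule two_degenerate_packing)
  then show "1 \<le> (4::nat) \<and> (\<forall>L. k_fold S 4 L \<longrightarrow> (\<exists>c. L_packing S E 4 L c))" by simp
next
  fix k :: nat
  assume k: "1 \<le> k \<and> (\<forall>L. k_fold S k L \<longrightarrow> (\<exists>c. L_packing S E k L c))"
  show "4 \<le> k"
  proof (rule ccontr)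
    assume "\<not> 4 \<le> k"
    then consider "k = 3" | "k \<le> 2" by linarith
    then show False
    proof cases
      case 1 then show False using k lists_3_fold not_3_packable by blast
    next
      case 2
      have "k_fold S k (\<lambda>_. {..<k})" by (simp add: k_fold_def)
      then show False using k not_small_packable[OF _ 2] by blast
    qed
  qed
qed

end

theorem theorem4p1:
  fixes g :: nat
  assumes "g \<ge> 3"
  shows "\<exists>(V :: nat set) (E :: nat set set). simple_graph V E \<and> planar_graph V E \<and>
           girth_at_least V E g \<and> list_packing_number V E = 4"
proof -
  \<comment> \<open>Here \<open>N\<close> is even and at least \<open>g\<close>, and
    \<open>h\<close> exceeds \<open>g\<close>, as \<open>girth\<close> requires.\<close>
  interpret lattice_graph "2 * int g" "int g + 1"
    using assms by unfold_locales auto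
  let ?V = "to_nat ` S" and ?E = "(`) to_nat ` E"
  have inj: "inj_on to_nat A" for A :: "(int \<times> int) set"
    by (rule inj_on_subset[OF inj_to_nat]) simp
  have "simple_graph ?V ?E"
    unfolding simple_graph_def
  proof (intro conjI ballI)
    fix e assume "e \<in> ?E"
    then obtain d where d: "d \<in> E" "e = to_nat ` d" by blast
    then show "e \<subseteq> ?V" "card e = 2" using simple_E inj[of d] by (auto simp: card_image)
  qed (simp add: finite_S)
  moreover have "planar_graph ?V ?E" using inj_to_nat planar by (rule planar_graph_image)
  moreover have "girth_at_least ?V ?E g"
    by (intro girth_at_least_image[OF inj_to_nat] girth) simp_all
  moreover have "list_packing_number ?V ?E = 4"
    using list_packing_number_image[OF inj simple_E] list_packing_number_eq_4 by simp
  ultimately show ?thesis by blast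
qed

end
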